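(* Let $\mathcal A=\{A(0),\dots,A(s-1)\}$ be a finite set of nonnegative $2\times 2$ matrices, let $p_0,\dots,p_{s-1}>0$ with $\sum_k p_k=1$, let $\{0,\dots,s-1\}^{\mathbb N}$ be endowed with the corresponding product probability, and for $\omega=(\omega_n)$ in this space let $P_n=A(\omega_1)\cdots A(\omega_n)$. Assume that at least one of the $A(k)$ has neither the form $\begin{pmatrix}a&0\\0&d\end{pmatrix}$ with $ad\ne0$, nor the form $\begin{pmatrix}0&b\\c&0\end{pmatrix}$ with $bc\ne0$. Then the limit points of the normalized product matrix $\frac{P_n}{\Vert P_n\Vert}$ have almost surely rank $1$, and for every nonnegative column vector $V$ the vector $\frac{P_nV}{\Vert P_nV\Vert}$ converges almost surely. Moreover, under this assumption the limits of the normalized columns of $P_n$ can be distinct (there are such sets $\mathcal A$ and probabilities for which the two normalized columns converge almost surely to distinct limits), and the rate of convergence of $\frac{P_nV}{\Vert P_nV\Vert}$ can be exponential or not exponential (depending on the case, both possibilities occur).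
   Context: For a column vector, $\Vert\cdot\Vert$ is the norm-1 (sum of absolute values of the entries); for a matrix it is the corresponding matrix norm (maximum of the norms-1 of the columns). The normalized columns of $P_n$ are its nonnull columns divided by their norm-1. The rate of convergence is exponential if the absolute differences between the entries and their limits are less than $Cr^n$ for some $C>0$ and $0<r<1$. So that the normalized quantities are defined, it is assumed that $P_n\neq0$ for all $n$ almost surely, and statements about $\frac{P_nV}{\Vert P_nV\Vert}$ concern those $\omega$ for which $P_nV\ne0$ for all $n$. *)

theory Defs
  imports "HOL-Probability.Probability"
begin

definition norm1 :: "real^2 \<Rightarrow> real" where
  "norm1 v = (\<Sum>i\<in>UNIV. \<bar>v $ i\<bar>)"

definition matrix_norm1 :: "real^2^2 \<Rightarrow> real" where
  "matrix_norm1 M = Max (range (\<lambda>j. norm1 (column j M)))"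

text \<open>Both normalizations return 0 at 0; this value is never relevant below.\<close>

definition normalize_vec :: "real^2 \<Rightarrow> real^2" where
  "normalize_vec v = (1 / norm1 v) *\<^sub>R v"

definition normalize_mat :: "real^2^2 \<Rightarrow> real^2^2" where
  "normalize_mat M = (1 / matrix_norm1 M) *\<^sub>R M"

definition nonneg_vec :: "real^2 \<Rightarrow> bool" where
  "nonneg_vec v \<longleftrightarrow> (\<forall>i. 0 \<le> v $ i)"

definition nonneg_mat :: "real^2^2 \<Rightarrow> bool" where
  "nonneg_mat M \<longleftrightarrow> (\<forall>i j. 0 \<le> M $ i $ j)"

definition diagonal_form :: "real^2^2 \<Rightarrow> bool" where
  "diagonal_form M \<longleftrightarrow>
     (\<exists>a d. a * d \<noteq> 0 \<and> M = vector [vector [a, 0], vector [0, d]])"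

definition antidiagonal_form :: "real^2^2 \<Rightarrow> bool" where
  "antidiagonal_form M \<longleftrightarrow>
     (\<exists>b c. b * c \<noteq> 0 \<and> M = vector [vector [0, b], vector [c, 0]])"

text \<open>The product probability on the sequences with values in \<open>{0, \<dots>, s - 1}\<close>.\<close>

definition product_prob :: "nat \<Rightarrow> (nat \<Rightarrow> real) \<Rightarrow> (nat \<Rightarrow> nat) measure" where
  "product_prob s p =
     Pi\<^sub>M UNIV (\<lambda>_. point_measure {..<s} (\<lambda>k. ennreal (p k)))"

text \<open>Sequences are indexed from 0, so \<open>\<omega> i\<close> stands for \<open>\<omega>\<close> at position \<open>i + 1\<close>
  and \<open>mat_product A \<omega> n\<close> is the product of the first \<open>n\<close> factors.\<close>

primrec mat_product :: "(nat \<Rightarrow> real^2^2) \<Rightarrow> (nat \<Rightarrow> nat) \<Rightarrow> nat \<Rightarrow> real^2^2" where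
  "mat_product A \<omega> 0 = mat 1"
| "mat_product A \<omega> (Suc n) = mat_product A \<omega> n ** A (\<omega> n)"

text \<open>The standing assumptions, including that almost surely no product vanishes.\<close>

definition random_product_setting ::
  "nat \<Rightarrow> (nat \<Rightarrow> real^2^2) \<Rightarrow> (nat \<Rightarrow> real) \<Rightarrow> bool" where
  "random_product_setting s A p \<longleftrightarrow>
     (\<forall>k<s. nonneg_mat (A k)) \<and>
     (\<forall>k<s. 0 < p k) \<and> (\<Sum>k<s. p k) = 1 \<and>
     (AE \<omega> in product_prob s p. \<forall>n. mat_product A \<omega> n \<noteq> 0)"

definition some_not_monomial :: "nat \<Rightarrow> (nat \<Rightarrow> real^2^2) \<Rightarrow> bool" where
  "some_not_monomial s A \<longleftrightarrow>
     (\<exists>k<s. \<not> diagonal_form (A k) \<and> \<not> antidiagonal_form (A k))"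

text \<open>Limit points of a sequence are its subsequential limits; \<open>islimpt\<close> on the range
  would miss values that the sequence takes infinitely often.\<close>

definition seq_limit_point :: "(nat \<Rightarrow> 'a::topological_space) \<Rightarrow> 'a \<Rightarrow> bool" where
  "seq_limit_point X L \<longleftrightarrow>
     (\<exists>r::nat \<Rightarrow> nat. strict_mono r \<and> (X \<circ> r) \<longlonglongrightarrow> L)"

definition exponential_rate :: "(nat \<Rightarrow> real^2) \<Rightarrow> bool" where
  "exponential_rate X \<longleftrightarrow>
     (\<exists>L. X \<longlonglongrightarrow> L \<and>
        (\<exists>C r. 0 < C \<and> 0 < r \<and> r < 1 \<and> (\<forall>n i. \<bar>X n $ i - L $ i\<bar> < C * r ^ n)))"

end

theory Submission
  imports Defs
begin

text \<open>
Multiplying on the right by nonnegative matrices makes the cone spanned by the columns of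
\<open>P\<^sub>n\<close> decrease. Once \<open>det P\<^sub>n / \<parallel>P\<^sub>n\<parallel>\<^sup>2 \<rightarrow> 0\<close> is known, the limit points of \<open>P\<^sub>n / \<parallel>P\<^sub>n\<parallel>\<close> are singular and
different from zero (\<open>rank_1_of_seq_limit_point\<close>). There are three cases.

If some \<open>A k\<close> is singular, it almost surely occurs; from then on \<open>P\<^sub>n\<close> has rank one with a fixed range,
and the direction of \<open>P\<^sub>n V\<close> is constant (\<open>convergent_of_singular\<close>).

If all \<open>A k\<close> are invertible and some word of length three has a positive product \<open>W\<close>, measure the cone
by \<open>cone_width\<close>, the distance between the normalized columns. It never increases, and by
\<open>cone_width_mult_le\<close> each occurrence of the word multiplies it by at most \<open>\<bar>det W\<bar> / perm W < 1\<close>. The word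
occurs infinitely often, so the cones shrink to a ray, which attracts all directions
(\<open>cone_width_tendsto_0\<close>, \<open>convergent_of_cone_width\<close>).

Otherwise all \<open>A k\<close> are triangular of the same shape, one of them with a nonzero shear
(\<open>positive_sandwich_or_triangular\<close>). In the upper triangular case write \<open>P\<^sub>n\<close> as a multiple of the matrix
with rows \<open>(x\<^sub>n, s\<^sub>n)\<close> and \<open>(0, 1)\<close>. Here \<open>x\<^sub>n\<close> is a multiplicative random walk and \<open>s\<^sub>n\<close> is
nondecreasing, with an increment proportional to \<open>x\<^sub>n\<close> when the sheared factor is chosen. Either
\<open>s\<^sub>n \<rightarrow> \<infinity>\<close>, or \<open>s\<^sub>n\<close> converges and then \<open>x\<^sub>n \<rightarrow> 0\<close>: if \<open>x\<^sub>n\<close> were infinitely often at least \<open>\<epsilon>\<close>, the sheared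
factor would follow infinitely often at such times, by a conditional form of the Borel-Cantelli lemma
(\<open>AE_infinitely_often_letter\<close>), and \<open>s\<^sub>n\<close> would be unbounded. Both alternatives
(\<open>slope_at_top_or_ratio_tendsto_0\<close>) give the convergence of determinants and directions.

The three existence claims are witnessed by the powers of one matrix: a triangular
matrix with distinct eigenvalues, all of whose powers keep the non-attracting eigenvector as first
column, the all-ones matrix, and the unipotent shear.
\<close>

section \<open>Recurrent visits of an independent sequence\<close>

lemma measurable_history:
  fixes M :: "'a::countable measure"
  assumes sets: "sets M = Pow (space M)"
  shows "(\<lambda>\<omega>. map \<omega> [0..<n]) \<in> (\<Pi>\<^sub>M i\<in>(UNIV::nat set). M) \<rightarrow>\<^sub>M count_space (UNIV::'a list set)"
proof (induction n)
  case (Suc n)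
  have "(\<lambda>\<omega>. \<omega> n) \<in> (\<Pi>\<^sub>M i\<in>(UNIV::nat set). M) \<rightarrow>\<^sub>M M" by simp
  then have coord: "(\<lambda>\<omega>. \<omega> n) \<in> (\<Pi>\<^sub>M i\<in>(UNIV::nat set). M) \<rightarrow>\<^sub>M count_space (UNIV::'a set)"
    by (rule measurable_compose) (auto simp: measurable_def sets)
  have "(\<lambda>\<omega>. map \<omega> [0..<n] @ [\<omega> n]) \<in> (\<Pi>\<^sub>M i\<in>(UNIV::nat set). M) \<rightarrow>\<^sub>M count_space (UNIV::'a list set)"
    by (rule measurable_compose_countable[OF _ Suc], rule measurable_compose_countable[OF _ coord]) simp
  then show ?case by simp
qed simp

text \<open>The product is the fortune of a gambler who bets before each trial at which the history satisfies
\<open>G\<close>: he is ruined if the next letter is \<open>a\<close>, and his fortune is multiplied by \<open>c\<close> otherwise. Each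
bet is at best fair, so the fortune is a nonnegative supermartingale started at \<open>1\<close>. The induction
removes the first letter of the sequence, which replaces \<open>G\<close> by a shifted predicate; therefore
\<open>G\<close> has to be arbitrary.\<close>

lemma nn_integral_gambler_le_1:
  fixes M :: "'a::countable measure" and c :: ennreal and G :: "'a list \<Rightarrow> bool"
  assumes M: "prob_space M" and sets: "sets M = Pow (space M)"
    and fair: "(\<integral>\<^sup>+x. (if x = a then 0 else c) \<partial>M) \<le> 1"
  shows "(\<integral>\<^sup>+\<omega>. (\<Prod>i<n. if G (map \<omega> [0..<i]) then if \<omega> i = a then 0 else c else 1)
           \<partial>(\<Pi>\<^sub>M i\<in>(UNIV::nat set). M)) \<le> 1"
proof (induction n arbitrary: G)
  case 0
  interpret M: prob_space M by fact
  interpret product_prob_space "\<lambda>_. M" "UNIV::nat set" ..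
  show ?case by (simp add: emeasure_space_1)
next
  case (Suc n)
  interpret M: prob_space M by fact
  interpret sequence_space M ..
  define f where "f G x = (if G then if x = a then 0 else c else (1::ennreal))" for G x
  define Z where "Z n G \<omega> = (\<Prod>i<n. f (G (map \<omega> [0..<i])) (\<omega> i))" for n G and \<omega> :: "nat \<Rightarrow> 'a"
  have Z_hist: "Z n G \<omega> = (\<lambda>h. \<Prod>i<n. f (G (take i h)) (h ! i)) (map \<omega> [0..<n])" for n G \<omega>
    unfolding Z_def by (intro prod.cong) (auto simp: take_map)
  have [measurable]: "Z n G \<in> borel_measurable S" for n G
    unfolding Z_hist by (rule measurable_compose[OF measurable_history[OF sets]]) simp
  have map_shift: "map (case_nat x \<omega>) [0..<Suc i] = x # map \<omega> [0..<i]" for x :: 'a and \<omega> i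
    by (simp add: upt_conv_Cons map_Suc_upt[symmetric] comp_def del: upt_Suc)
  have peel: "Z (Suc n) G (case_nat x \<omega>) = f (G []) x * Z n (\<lambda>h. G (x # h)) \<omega>" for x \<omega>
    unfolding Z_def prod.lessThan_Suc_shift by (simp add: map_shift del: upt_Suc)
  have "(\<integral>\<^sup>+\<omega>. Z (Suc n) G \<omega> \<partial>S) = (\<integral>\<^sup>+\<omega>. Z (Suc n) G \<omega> \<partial>(distr (M \<Otimes>\<^sub>M S) S (\<lambda>(s, \<omega>). case_nat s \<omega>)))"
    by (simp only: PiM_iter)
  also have "\<dots> = (\<integral>\<^sup>+y. Z (Suc n) G ((\<lambda>(s, \<omega>). case_nat s \<omega>) y) \<partial>(M \<Otimes>\<^sub>M S))"
    by (rule nn_integral_distr) simp_all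
  also have "\<dots> = (\<integral>\<^sup>+x. \<integral>\<^sup>+\<omega>. Z (Suc n) G (case_nat x \<omega>) \<partial>S \<partial>M)"
    by (subst P.nn_integral_fst[symmetric]) simp_all
  also have "\<dots> = (\<integral>\<^sup>+x. f (G []) x * (\<integral>\<^sup>+\<omega>. Z n (\<lambda>h. G (x # h)) \<omega> \<partial>S) \<partial>M)"
    by (simp add: peel nn_integral_cmult)
  also have "\<dots> \<le> (\<integral>\<^sup>+x. f (G []) x \<partial>M)"
  proof (rule nn_integral_mono)
    fix x
    have "(\<integral>\<^sup>+\<omega>. Z n (\<lambda>h. G (x # h)) \<omega> \<partial>S) \<le> 1"
      using Suc[of "\<lambda>h. G (x # h)"] unfolding Z_def f_def .
    then show "f (G []) x * (\<integral>\<^sup>+\<omega>. Z n (\<lambda>h. G (x # h)) \<omega> \<partial>S) \<le> f (G []) x"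
      using mult_left_mono[of _ 1 "f (G []) x"] by simp
  qed
  also have "\<dots> \<le> 1"
    using fair by (cases "G []") (simp_all add: f_def M.emeasure_space_1)
  finally show ?case unfolding Z_def f_def .
qed

text \<open>A conditional second Borel-Cantelli lemma. If \<open>G\<close> holds at infinitely many times but the letter
\<open>a\<close> follows only finitely often, then the gambler who starts to bet late enough is never ruined
and becomes infinitely rich. By Fatou's lemma the limit inferior of his fortune has a finite
integral, so this has probability zero. It is applied to events about the position of a
random walk, which depend on the whole past.\<close>

lemma AE_infinitely_often_letter:
  fixes M :: "'a::countable measure" and G :: "'a list \<Rightarrow> bool"
  assumes M: "prob_space M" and sets: "sets M = Pow (space M)"
    and pos: "0 < measure M {a}"
  shows "AE \<omega> in (\<Pi>\<^sub>M i\<in>(UNIV::nat set). M).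
    (\<exists>\<^sub>\<infinity>n. G (map \<omega> [0..<n])) \<longrightarrow> (\<exists>\<^sub>\<infinity>n. G (map \<omega> [0..<n]) \<and> \<omega> n = a)"
proof -
  interpret M: prob_space M by fact
  interpret sequence_space M ..
  \<comment> \<open>Halving the probability keeps the factor finite when the letter has probability one,
    and still leaves it larger than one.\<close>
  define c :: real where "c = 1 / (1 - measure M {a} / 2)"
  have le1: "measure M {a} \<le> 1" by simp
  have c1: "c > 1" and c: "c * (1 - measure M {a}) \<le> 1"
    using pos le1 unfolding c_def by (simp_all add: divide_simps del: M.prob_le_1)
  have a: "a \<in> space M"
    using pos sets by (metis Pow_iff insert_subset measure_notin_sets order_less_irrefl empty_subsetI)
  have "(\<integral>\<^sup>+x. (if x = a then 0 else ennreal c) \<partial>M) = (\<integral>\<^sup>+x. ennreal c * indicator (space M - {a}) x \<partial>M)"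
    by (intro nn_integral_cong) (auto simp: indicator_def)
  also have "\<dots> = ennreal c * emeasure M (space M - {a})"
    using a sets by (intro nn_integral_cmult_indicator) auto
  also have "\<dots> = ennreal (c * (1 - measure M {a}))"
    using a sets c1 M.prob_compl[of "{a}"]
    by (simp add: M.emeasure_eq_measure ennreal_mult)
  also have "\<dots> \<le> 1"
    using c by (simp add: ennreal_le_1)
  finally have fair: "(\<integral>\<^sup>+x. (if x = a then 0 else ennreal c) \<partial>M) \<le> 1" .
  \<comment> \<open>The gambler of index \<open>N\<close> places no bet before time \<open>N\<close>.\<close>
  define GN where "GN N h \<longleftrightarrow> N \<le> length h \<and> G h" for N h
  define Z where "Z N n \<omega> = (\<Prod>i<n. if GN N (map \<omega> [0..<i]) then if \<omega> i = a then 0 else ennreal c else 1)"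
    for N n and \<omega> :: "nat \<Rightarrow> 'a"
  have Z_hist: "Z N n \<omega> = (\<lambda>h. \<Prod>i<n. if GN N (take i h) then if h ! i = a then 0 else ennreal c else 1) (map \<omega> [0..<n])" for N n \<omega>
    unfolding Z_def by (intro prod.cong) (auto simp: take_map)
  have [measurable]: "Z N n \<in> borel_measurable S" for N n
    unfolding Z_hist by (rule measurable_compose[OF measurable_history[OF sets]]) simp
  have "AE \<omega> in S. liminf (\<lambda>n. Z N n \<omega>) \<noteq> \<infinity>" for N
  proof (rule nn_integral_PInf_AE)
    have "(\<integral>\<^sup>+\<omega>. liminf (\<lambda>n. Z N n \<omega>) \<partial>S) \<le> liminf (\<lambda>n. integral\<^sup>N S (Z N n))"
      by (rule nn_integral_liminf) simp
    also have "\<dots> \<le> liminf (\<lambda>n. 1)"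
      unfolding Z_def
      by (intro Liminf_mono always_eventually allI nn_integral_gambler_le_1[OF M sets fair])
    also have "\<dots> = 1" by (simp add: Liminf_const)
    finally have "(\<integral>\<^sup>+\<omega>. liminf (\<lambda>n. Z N n \<omega>) \<partial>S) \<le> 1" .
    then show "(\<integral>\<^sup>+\<omega>. liminf (\<lambda>n. Z N n \<omega>) \<partial>S) \<noteq> \<infinity>" by (auto simp: top_unique)
  qed simp
  then have "AE \<omega> in S. \<forall>N. liminf (\<lambda>n. Z N n \<omega>) \<noteq> \<infinity>"
    by (simp add: AE_all_countable)
  then show ?thesis
  proof eventually_elim
    case (elim \<omega>)
    show ?case
    proof (rule impI, rule ccontr)
      assume inf: "\<exists>\<^sub>\<infinity>n. G (map \<omega> [0..<n])" and "\<not> (\<exists>\<^sub>\<infinity>n. G (map \<omega> [0..<n]) \<and> \<omega> n = a)"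
      then obtain N where N: "\<And>n. n \<ge> N \<Longrightarrow> G (map \<omega> [0..<n]) \<Longrightarrow> \<omega> n \<noteq> a"
        unfolding INFM_nat_le by blast
      have "infinite {n. GN N (map \<omega> [0..<n])}"
        using inf unfolding GN_def INFM_nat_le infinite_nat_iff_unbounded_le
        by (metis (mono_tags, lifting) mem_Collect_eq length_map length_upt diff_zero max.bounded_iff)
      have "ennreal (c ^ m) \<le> liminf (\<lambda>n. Z N n \<omega>)" for m
      proof -
        obtain B where B: "finite B" "card B = m" "B \<subseteq> {n. GN N (map \<omega> [0..<n])}"
          using infinite_arbitrarily_large[OF \<open>infinite _\<close>] by blast
        then obtain b where b: "\<And>i. i \<in> B \<Longrightarrow> i < b"
          using finite_nat_set_iff_bounded[of B] by auto
        have "ennreal (c ^ m) \<le> Z N n \<omega>" if "n \<ge> b" for n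
        proof -
          let ?D = "{i. i < n \<and> GN N (map \<omega> [0..<i])}"
          have "Z N n \<omega> = (\<Prod>i<n. if i \<in> ?D then ennreal c else 1)"
            unfolding Z_def using N by (intro prod.cong) (auto simp: GN_def)
          also have "\<dots> = ennreal c ^ card ?D"
            by (subst prod.If_cases) (simp_all add: Int_def conj_ac)
          finally have "Z N n \<omega> = ennreal (c ^ card ?D)"
            using c1 by (simp add: ennreal_power)
          moreover have "card B \<le> card ?D"
            using B b that by (intro card_mono) force+
          ultimately show ?thesis
            using B(2) c1 by (auto intro!: ennreal_leI power_increasing)
        qed
        then show ?thesis
          by (intro Liminf_bounded) (auto simp: eventually_sequentially)
      qed
      moreover obtain r where r: "liminf (\<lambda>n. Z N n \<omega>) = ennreal r" "0 \<le> r"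
        using elim by (metis ennreal_cases infinity_ennreal_def)
      ultimately have "c ^ m \<le> r" for m
        by (metis ennreal_le_iff)
      then show False
        using real_arch_pow[OF c1, of r] by (meson not_le)
    qed
  qed
qed

text \<open>Letters are appended one at a time: each time the history ends with the part of the word built so
far is an occasion for the next letter.\<close>

lemma AE_infinitely_often_word:
  fixes M :: "'a::countable measure"
  assumes M: "prob_space M" and sets: "sets M = Pow (space M)"
    and pos: "\<And>a. a \<in> set w \<Longrightarrow> 0 < measure M {a}"
  shows "AE \<omega> in (\<Pi>\<^sub>M i\<in>(UNIV::nat set). M). \<exists>\<^sub>\<infinity>n. \<exists>h. map \<omega> [0..<n] = h @ w"
  using pos
proof (induction w rule: rev_induct)
  case Nil
  then show ?case by simp
next
  case (snoc a w)
  have "AE \<omega> in (\<Pi>\<^sub>M i\<in>(UNIV::nat set). M). \<exists>\<^sub>\<infinity>n. \<exists>h. map \<omega> [0..<n] = h @ w"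
    using snoc by simp
  moreover have "AE \<omega> in (\<Pi>\<^sub>M i\<in>(UNIV::nat set). M).
      (\<exists>\<^sub>\<infinity>n. \<exists>h. map \<omega> [0..<n] = h @ w) \<longrightarrow> (\<exists>\<^sub>\<infinity>n. (\<exists>h. map \<omega> [0..<n] = h @ w) \<and> \<omega> n = a)"
    by (rule AE_infinitely_often_letter[OF M sets]) (simp add: snoc.prems)
  ultimately show ?case
  proof eventually_elim
    case (elim \<omega>)
    then have inf: "\<exists>\<^sub>\<infinity>n. (\<exists>h. map \<omega> [0..<n] = h @ w) \<and> \<omega> n = a" by blast
    show ?case
      unfolding INFM_nat_le
    proof
      fix m
      obtain n h where "n \<ge> m" "map \<omega> [0..<n] = h @ w" "\<omega> n = a"
        using inf unfolding INFM_nat_le by blast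
      then have "Suc n \<ge> m" "map \<omega> [0..<Suc n] = h @ w @ [a]" by simp_all
      then show "\<exists>n\<ge>m. \<exists>h. map \<omega> [0..<n] = h @ w @ [a]" by blast
    qed
  qed
qed

section \<open>Nonnegative two-by-two matrices\<close>

lemma sum_UNIV_2_of_neq:
  fixes i j :: 2
  assumes "i \<noteq> j"
  shows "sum f UNIV = f i + f j"
proof -
  have "UNIV = {i, j}" using assms exhaust_2 by auto metis+
  then have "sum f UNIV = sum f {i, j}" by (simp only:)
  with assms show ?thesis by simp
qed

lemma det_2_triangular:
  fixes M :: "real^2^2"
  assumes "i \<noteq> j" "M $ j $ i = 0"
  shows "det M = M $ i $ i * M $ j $ j"
  using assms exhaust_2[of i] exhaust_2[of j] by (auto simp: det_2)

lemma norm1_nonneg_vec: "nonneg_vec v \<Longrightarrow> norm1 v = v $ 1 + v $ 2"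
  by (simp add: norm1_def sum_2 nonneg_vec_def)

lemma norm1_pos_iff: "0 < norm1 v \<longleftrightarrow> v \<noteq> 0"
  by (auto simp: norm1_def sum_2 vec_eq_iff forall_2)

lemma norm1_nonneg: "0 \<le> norm1 v"
  by (simp add: norm1_def sum_nonneg)

lemma nonneg_vec_mult: "nonneg_mat P \<Longrightarrow> nonneg_vec x \<Longrightarrow> nonneg_vec (P *v x)"
  by (auto simp: nonneg_vec_def nonneg_mat_def matrix_vector_mult_def intro!: sum_nonneg)

lemma nonneg_mat_mult: "nonneg_mat P \<Longrightarrow> nonneg_mat Q \<Longrightarrow> nonneg_mat (P ** Q)"
  by (auto simp: nonneg_mat_def matrix_matrix_mult_def intro!: sum_nonneg)

lemma nonneg_vec_column: "nonneg_mat P \<Longrightarrow> nonneg_vec (column j P)"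
  by (simp add: nonneg_vec_def nonneg_mat_def column_def)

lemma column_mult: "column j (P ** W) = P *v column j W"
  by (simp add: column_def matrix_matrix_mult_def matrix_vector_mult_def vec_eq_iff)

lemma norm1_mult:
  assumes "nonneg_mat P" "nonneg_vec x"
  shows "norm1 (P *v x) = norm1 (column 1 P) * x $ 1 + norm1 (column 2 P) * x $ 2"
  using assms
  by (simp add: norm1_nonneg_vec nonneg_vec_mult nonneg_vec_column)
     (simp add: matrix_vector_mult_def sum_2 column_def algebra_simps)

lemma column_nonzero_of_det: "det (P :: real^2^2) \<noteq> 0 \<Longrightarrow> column j P \<noteq> 0"
  using exhaust_2[of j] by (auto simp: det_2 column_def vec_eq_iff forall_2)

lemma mult_nonzero_of_det:
  fixes P :: "real^2^2"
  assumes "det P \<noteq> 0" "x \<noteq> 0"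
  shows "P *v x \<noteq> 0"
  using assms det_eq_0_rank[of P] matrix_nonfull_linear_equations_eq[of P] rank_bound[of P] by auto

section \<open>The matrix norm and limit points of rank one\<close>

lemma norm1_column_le_matrix_norm1: "norm1 (column j M) \<le> matrix_norm1 M"
  unfolding matrix_norm1_def by (intro Max_ge) auto

lemma entry_le_matrix_norm1: "\<bar>M $ i $ j\<bar> \<le> matrix_norm1 M"
proof -
  have "\<bar>M $ i $ j\<bar> \<le> norm1 (column j M)"
    unfolding norm1_def column_def using exhaust_2[of i] by (auto simp: sum_2)
  also have "\<dots> \<le> matrix_norm1 M" by (rule norm1_column_le_matrix_norm1)
  finally show ?thesis .
qed

lemma matrix_norm1_pos: "M \<noteq> 0 \<Longrightarrow> 0 < matrix_norm1 M"
proof -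
  assume "M \<noteq> 0"
  then obtain i j where "M $ i $ j \<noteq> 0" by (auto simp: vec_eq_iff)
  then show ?thesis using entry_le_matrix_norm1[of M i j] by linarith
qed

lemma matrix_norm1_le_sum: "matrix_norm1 M \<le> (\<Sum>i\<in>UNIV. \<Sum>j\<in>UNIV. \<bar>M $ i $ j\<bar>)"
proof -
  have "matrix_norm1 M \<in> range (\<lambda>j. norm1 (column j M))"
    unfolding matrix_norm1_def by (intro Max_in) auto
  then obtain j where j: "matrix_norm1 M = norm1 (column j M)" by auto
  show ?thesis
    unfolding j norm1_def column_def using exhaust_2[of j] by (auto simp: sum_2)
qed

lemma det_normalize_mat: "det (normalize_mat M) = det M / (matrix_norm1 M)\<^sup>2"
  by (simp add: normalize_mat_def det_2 diff_divide_distrib power2_eq_square)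

text \<open>The entries of a normalized matrix have absolute values with sum at least \<open>1\<close>, so a limit point
does not vanish; its determinant is zero by continuity.\<close>

lemma rank_1_of_seq_limit_point:
  assumes nz: "\<And>n. M n \<noteq> 0"
    and det: "(\<lambda>n. det (normalize_mat (M n))) \<longlonglongrightarrow> 0"
    and L: "seq_limit_point (\<lambda>n. normalize_mat (M n)) L"
  shows "rank L = 1"
proof -
  obtain r where r: "strict_mono r" and lim: "((\<lambda>n. normalize_mat (M n)) \<circ> r) \<longlonglongrightarrow> L"
    using L by (auto simp: seq_limit_point_def)
  have entry: "(\<lambda>n. normalize_mat (M (r n)) $ i $ j) \<longlonglongrightarrow> L $ i $ j" for i j
    using tendsto_vec_nth[OF tendsto_vec_nth[OF lim]] by (simp add: comp_def)
  have "(\<lambda>n. det (normalize_mat (M (r n)))) \<longlonglongrightarrow> det L"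
    unfolding det_2 by (intro tendsto_intros entry)
  moreover have "(\<lambda>n. det (normalize_mat (M (r n)))) \<longlonglongrightarrow> 0"
    using LIMSEQ_subseq_LIMSEQ[OF det r] by (simp add: comp_def)
  ultimately have "det L = 0" by (rule LIMSEQ_unique)
  then have "rank L < 2" by (simp add: det_eq_0_rank)
  have "1 \<le> (\<Sum>i\<in>UNIV. \<Sum>j\<in>UNIV. \<bar>normalize_mat (M n) $ i $ j\<bar>)" for n
  proof -
    have pos: "0 < matrix_norm1 (M n)" by (rule matrix_norm1_pos[OF nz])
    have "(\<Sum>i\<in>UNIV. \<Sum>j\<in>UNIV. \<bar>normalize_mat (M n) $ i $ j\<bar>)
        = (\<Sum>i\<in>UNIV. \<Sum>j\<in>UNIV. \<bar>M n $ i $ j\<bar>) / matrix_norm1 (M n)"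
      using pos by (simp add: normalize_mat_def sum_2 abs_mult add_divide_distrib)
    then show ?thesis using matrix_norm1_le_sum[of "M n"] pos by (simp only: le_divide_eq_1_pos)
  qed
  moreover have "(\<lambda>n. \<Sum>i\<in>UNIV. \<Sum>j\<in>UNIV. \<bar>normalize_mat (M (r n)) $ i $ j\<bar>)
      \<longlonglongrightarrow> (\<Sum>i\<in>UNIV. \<Sum>j\<in>UNIV. \<bar>L $ i $ j\<bar>)"
    by (intro tendsto_intros entry)
  ultimately have "1 \<le> (\<Sum>i\<in>UNIV. \<Sum>j\<in>UNIV. \<bar>L $ i $ j\<bar>)"
    by (intro LIMSEQ_le_const[of _ _ 1]) auto
  then have "L \<noteq> 0" by auto
  then have "rank L \<noteq> 0" by (simp add: rank_eq_0)
  with \<open>rank L < 2\<close> show ?thesis by linarith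
qed

section \<open>The width of the cone spanned by the columns\<close>

text \<open>For a nonnegative matrix with nonzero columns this is the distance, in each coordinate, between the two normalized
columns.\<close>

definition cone_width :: "real^2^2 \<Rightarrow> real" where
  "cone_width P = \<bar>det P\<bar> / (norm1 (column 1 P) * norm1 (column 2 P))"

lemma cone_width_nonneg: "0 \<le> cone_width P"
  by (simp add: cone_width_def norm1_nonneg)

lemma normalize_vec_diff:
  assumes "nonneg_vec u" "nonneg_vec v" "u \<noteq> 0" "v \<noteq> 0"
  shows "\<bar>normalize_vec u $ i - normalize_vec v $ i\<bar> = \<bar>u $ 1 * v $ 2 - u $ 2 * v $ 1\<bar> / (norm1 u * norm1 v)"
proof -
  have u: "norm1 u = u $ 1 + u $ 2" "0 < u $ 1 + u $ 2" and v: "norm1 v = v $ 1 + v $ 2" "0 < v $ 1 + v $ 2"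
    using assms norm1_pos_iff[of u] norm1_pos_iff[of v] by (simp_all add: norm1_nonneg_vec)
  have "normalize_vec u $ 1 - normalize_vec v $ 1 = (u $ 1 * v $ 2 - u $ 2 * v $ 1) / (norm1 u * norm1 v)"
    using u v by (simp add: normalize_vec_def field_simps)
  moreover have "normalize_vec u $ 2 - normalize_vec v $ 2 = - (u $ 1 * v $ 2 - u $ 2 * v $ 1) / (norm1 u * norm1 v)"
    using u v by (simp add: normalize_vec_def field_simps)
  ultimately show ?thesis
    using exhaust_2[of i] u v by (auto simp: abs_mult)
qed

text \<open>On nonnegative vectors \<open>norm1\<close> is additive. The product of the two norms therefore expands, and
dropping the two diagonal terms leaves the permanent of the matrix with columns \<open>x\<close> and \<open>y\<close>.\<close>

lemma norm1_mult_product_ge: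
  assumes P: "nonneg_mat P" and x: "nonneg_vec x" and y: "nonneg_vec y"
  shows "norm1 (column 1 P) * norm1 (column 2 P) * (x $ 1 * y $ 2 + x $ 2 * y $ 1)
    \<le> norm1 (P *v x) * norm1 (P *v y)"
proof -
  have "0 \<le> norm1 (column 1 P) ^ 2 * (x $ 1 * y $ 1) + norm1 (column 2 P) ^ 2 * (x $ 2 * y $ 2)"
    using x y by (simp add: nonneg_vec_def)
  then show ?thesis
    unfolding norm1_mult[OF P x] norm1_mult[OF P y] by (simp add: algebra_simps power2_eq_square)
qed

lemma cross_mult:
  fixes P :: "real^2^2"
  shows "(P *v x) $ 1 * (P *v y) $ 2 - (P *v x) $ 2 * (P *v y) $ 1
    = det P * (x $ 1 * y $ 2 - x $ 2 * y $ 1)"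
  by (simp add: det_2 matrix_vector_mult_def sum_2 algebra_simps)

text \<open>The normalized images of the cone of nonnegative vectors lie in the segment between the normalized
columns. In formulas: the determinant of \<open>[x, y]\<close> is at most its permanent.\<close>

lemma normalize_vec_diff_le_cone_width:
  assumes P: "nonneg_mat P" "det P \<noteq> 0"
    and x: "nonneg_vec x" "x \<noteq> 0" and y: "nonneg_vec y" "y \<noteq> 0"
  shows "\<bar>normalize_vec (P *v x) $ i - normalize_vec (P *v y) $ i\<bar> \<le> cone_width P"
proof -
  have nz: "P *v x \<noteq> 0" "P *v y \<noteq> 0"
    using mult_nonzero_of_det[OF P(2)] x(2) y(2) by blast+
  define n where "n = norm1 (column 1 P) * norm1 (column 2 P)"
  define N where "N = norm1 (P *v x) * norm1 (P *v y)"
  define D where "D = x $ 1 * y $ 2 - x $ 2 * y $ 1"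
  have "0 < n" "0 < N"
    using nz P column_nonzero_of_det[OF P(2)] by (auto simp: n_def N_def norm1_pos_iff)
  have "\<bar>D\<bar> \<le> x $ 1 * y $ 2 + x $ 2 * y $ 1"
    using x y unfolding D_def nonneg_vec_def by (simp add: abs_le_iff)
  then have "n * \<bar>D\<bar> \<le> N"
    using norm1_mult_product_ge[OF P(1) x(1) y(1)] \<open>0 < n\<close> unfolding n_def N_def
    by (meson mult_left_mono order_less_imp_le order_trans)
  then have "\<bar>det P\<bar> * (n * \<bar>D\<bar>) \<le> \<bar>det P\<bar> * N"
    by (intro mult_left_mono) auto
  then have "\<bar>det P\<bar> * \<bar>D\<bar> / N \<le> \<bar>det P\<bar> / n"
    using \<open>0 < n\<close> \<open>0 < N\<close> by (simp add: divide_simps mult_ac)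
  then show ?thesis
    using normalize_vec_diff[OF nonneg_vec_mult[OF P(1) x(1)] nonneg_vec_mult[OF P(1) y(1)] nz]
    unfolding cross_mult by (simp add: abs_mult cone_width_def n_def N_def D_def)
qed

text \<open>The determinant and the permanent are the difference and the sum of the same two products, which are
nonnegative for a nonnegative matrix. So their ratio is at most \<open>1\<close>, and smaller than \<open>1\<close> if both
products are positive.\<close>

definition contraction_coeff :: "real^2^2 \<Rightarrow> real" where
  "contraction_coeff W = \<bar>det W\<bar> / (W $ 1 $ 1 * W $ 2 $ 2 + W $ 1 $ 2 * W $ 2 $ 1)"

lemma permanent_pos:
  assumes "nonneg_mat W" "det W \<noteq> 0"
  shows "0 < W $ 1 $ 1 * W $ 2 $ 2 + W $ 1 $ 2 * W $ 2 $ 1"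
proof -
  have "0 \<le> W $ 1 $ 1 * W $ 2 $ 2" "0 \<le> W $ 1 $ 2 * W $ 2 $ 1"
    using assms(1) by (simp_all add: nonneg_mat_def)
  with assms(2) show ?thesis unfolding det_2 by linarith
qed

lemma contraction_coeff_le_1:
  assumes "nonneg_mat W" "det W \<noteq> 0"
  shows "contraction_coeff W \<le> 1"
  using assms permanent_pos[OF assms] unfolding contraction_coeff_def
  by (simp add: nonneg_mat_def det_2 abs_le_iff)

lemma contraction_coeff_less_1:
  assumes "\<And>i j. 0 < W $ i $ j"
  shows "contraction_coeff W < 1"
proof -
  have "0 < W $ 1 $ 1 * W $ 2 $ 2" "0 < W $ 1 $ 2 * W $ 2 $ 1"
    using assms by simp_all
  then show ?thesis
    unfolding contraction_coeff_def by (simp add: det_2 abs_less_iff)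
qed

text \<open>The determinant is multiplicative, while the norms of the two new columns are bounded below by
the old norms and the permanent of \<open>W\<close>. The resulting factor does not depend on \<open>P\<close>, so every
occurrence of a fixed positive block contracts by the same amount.\<close>

lemma cone_width_mult_le:
  assumes P: "nonneg_mat P" "det P \<noteq> 0" and W: "nonneg_mat W" "det W \<noteq> 0"
  shows "cone_width (P ** W) \<le> contraction_coeff W * cone_width P"
proof -
  define n where "n = norm1 (column 1 P) * norm1 (column 2 P)"
  define N where "N = norm1 (P *v column 1 W) * norm1 (P *v column 2 W)"
  define q where "q = W $ 1 $ 1 * W $ 2 $ 2 + W $ 1 $ 2 * W $ 2 $ 1"
  have "0 < n"
    using P column_nonzero_of_det[OF P(2)] by (auto simp: n_def norm1_pos_iff)
  moreover have "0 < q" using permanent_pos[OF W] by (simp add: q_def)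
  moreover have "n * q \<le> N"
    using norm1_mult_product_ge[OF P(1) nonneg_vec_column[OF W(1), of 1] nonneg_vec_column[OF W(1), of 2]]
    by (simp add: n_def N_def q_def column_def mult_ac)
  ultimately have "\<bar>det P * det W\<bar> / N \<le> \<bar>det P * det W\<bar> / (n * q)"
    by (intro divide_left_mono mult_pos_pos) (auto intro: less_le_trans[of _ "n * q"])
  then show ?thesis
    by (simp add: cone_width_def column_mult det_mul contraction_coeff_def N_def n_def q_def abs_mult mult_ac)
qed

lemma det_normalize_le_cone_width:
  assumes "det P \<noteq> 0"
  shows "\<bar>det (normalize_mat P)\<bar> \<le> cone_width P"
proof -
  have "norm1 (column 1 P) * norm1 (column 2 P) \<le> (matrix_norm1 P)\<^sup>2"
    unfolding power2_eq_square
    by (intro mult_mono norm1_column_le_matrix_norm1 norm1_nonneg order_trans[OF norm1_nonneg norm1_column_le_matrix_norm1])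
  moreover have pos: "0 < norm1 (column j P)" for j
    using column_nonzero_of_det[OF assms] by (simp add: norm1_pos_iff)
  moreover have "0 < norm1 (column 1 P) * norm1 (column 2 P)"
    by (intro mult_pos_pos pos)
  ultimately show ?thesis
    unfolding det_normalize_mat cone_width_def abs_divide
    using frac_le[of "\<bar>det P\<bar>" "\<bar>det P\<bar>" "norm1 (column 1 P) * norm1 (column 2 P)"] by simp
qed

section \<open>Products along a sequence and singular factors\<close>

definition word_product :: "(nat \<Rightarrow> real^2^2) \<Rightarrow> nat list \<Rightarrow> real^2^2" where
  "word_product A h = foldl (\<lambda>P k. P ** A k) (mat 1) h"

lemma word_product_simps [simp]:
  "word_product A [] = mat 1"
  "word_product A (h @ [k]) = word_product A h ** A k"
  by (simp_all add: word_product_def)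

lemma mat_product_eq_word_product: "mat_product A \<omega> n = word_product A (map \<omega> [0..<n])"
  by (induction n) simp_all

lemma mat_product_append:
  "mat_product A \<omega> (m + n) = mat_product A \<omega> m ** mat_product A (\<lambda>i. \<omega> (m + i)) n"
  by (induction n) (simp_all add: matrix_mul_assoc)

lemma nonneg_mat_product:
  assumes "\<And>i. nonneg_mat (A (\<omega> i))"
  shows "nonneg_mat (mat_product A \<omega> n)"
  by (induction n) (auto intro: nonneg_mat_mult assms, simp add: nonneg_mat_def mat_def)

lemma det_mat_product_nonzero:
  assumes "\<And>i. det (A (\<omega> i)) \<noteq> 0"
  shows "det (mat_product A \<omega> n) \<noteq> 0"
  by (induction n) (auto simp: det_mul assms)

lemma normalize_vec_eq_of_cross_0:
  assumes "nonneg_vec u" "nonneg_vec v" "u \<noteq> 0" "v \<noteq> 0" "u $ 1 * v $ 2 - u $ 2 * v $ 1 = 0"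
  shows "normalize_vec u = normalize_vec v"
  using normalize_vec_diff[OF assms(1-4)] assms(5) by (simp add: vec_eq_iff)

text \<open>After a singular factor the product has an at most one-dimensional range, so all later normalized vectors
coincide.\<close>

lemma convergent_of_singular:
  assumes nonneg: "\<And>i. nonneg_mat (A (\<omega> i))" and V: "nonneg_vec V"
    and nz: "\<And>n. mat_product A \<omega> n *v V \<noteq> 0"
    and m: "det (mat_product A \<omega> m) = 0"
  shows "convergent (\<lambda>n. normalize_vec (mat_product A \<omega> n *v V))"
proof -
  let ?P = "\<lambda>n. mat_product A \<omega> n"
  have "normalize_vec (?P n *v V) = normalize_vec (?P m *v V)" if "n \<ge> m" for n
  proof -
    define Q where "Q = mat_product A (\<lambda>i. \<omega> (m + i)) (n - m)"
    have eq: "?P n *v V = ?P m *v (Q *v V)"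
      using mat_product_append[of A \<omega> m "n - m"] that by (simp add: Q_def matrix_vector_mul_assoc)
    show ?thesis
      using cross_mult[of "?P m" "Q *v V" V] nz m unfolding eq[symmetric]
      by (intro normalize_vec_eq_of_cross_0 nonneg_vec_mult nonneg_mat_product nonneg V) auto
  qed
  then have "(\<lambda>n. normalize_vec (?P n *v V)) \<longlonglongrightarrow> normalize_vec (?P m *v V)"
    by (intro tendsto_eventually eventually_sequentiallyI[of m])
  then show ?thesis by (rule convergentI)
qed

lemma det_tendsto_0_of_singular:
  assumes "det (mat_product A \<omega> m) = 0"
  shows "(\<lambda>n. det (normalize_mat (mat_product A \<omega> n))) \<longlonglongrightarrow> 0"
proof (intro tendsto_eventually eventually_sequentiallyI)
  fix n assume "m \<le> n"
  then have "det (mat_product A \<omega> n) = 0"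
    using mat_product_append[of A \<omega> m "n - m"] assms by (simp add: det_mul)
  then show "det (normalize_mat (mat_product A \<omega> n)) = 0"
    by (simp add: det_normalize_mat)
qed

section \<open>Collapse of the cones along a positive word\<close>

text \<open>The bounded delay \<open>d\<close> accounts for the length of a block: the value after the block is compared with
the value before it. If the limit were positive, late values before a block would be so close to it
that the contraction would push the value after the block below the limit.\<close>

lemma contraction_tendsto_0:
  fixes w :: "nat \<Rightarrow> real"
  assumes nonneg: "\<And>n. 0 \<le> w n" and dec: "decseq w" and q: "q < 1"
    and contr: "\<exists>\<^sub>\<infinity>n. \<exists>m\<le>n. m + d \<ge> n \<and> w n \<le> q * w m"
  shows "w \<longlonglongrightarrow> 0"
proof -
  obtain l where l: "w \<longlonglongrightarrow> l" "\<And>n. l \<le> w n"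
    using decseq_convergent[OF dec, of 0] nonneg by blast
  have "0 \<le> l" using LIMSEQ_le_const[OF l(1), of 0] nonneg by blast
  have "\<not> 0 < l"
  proof
    assume "0 < l"
    have "(\<lambda>n. q * w n) \<longlonglongrightarrow> q * l" by (intro tendsto_intros l)
    moreover have "q * l < l" using q \<open>0 < l\<close> by simp
    ultimately have "\<forall>\<^sub>F n in sequentially. q * w n < l" by (rule order_tendstoD)
    then obtain N where N: "\<And>n. n \<ge> N \<Longrightarrow> q * w n < l" by (auto simp: eventually_sequentially)
    obtain n m where "n \<ge> N + d" "m + d \<ge> n" "w n \<le> q * w m"
      using contr unfolding INFM_nat_le by blast
    then show False using N[of m] l(2)[of n] by linarith
  qed
  with \<open>0 \<le> l\<close> l(1) show ?thesis by (cases "l = 0") auto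
qed

lemma convergent_vec:
  fixes X :: "nat \<Rightarrow> real^'n"
  assumes "\<And>i. convergent (\<lambda>n. X n $ i)"
  shows "convergent X"
proof -
  obtain l where "\<And>i. (\<lambda>n. X n $ i) \<longlonglongrightarrow> l i" using assms unfolding convergent_def by metis
  then have "X \<longlonglongrightarrow> (\<chi> i. l i)" by (intro vec_tendstoI) simp
  then show ?thesis by (rule convergentI)
qed

text \<open>All vectors after time \<open>m\<close> are images under the product at time \<open>m\<close> of nonnegative vectors, so the
width at time \<open>m\<close> bounds the oscillation from then on.\<close>

lemma convergent_of_cone_width:
  assumes nonneg: "\<And>i. nonneg_mat (A (\<omega> i))" and inv: "\<And>i. det (A (\<omega> i)) \<noteq> 0"
    and width: "(\<lambda>n. cone_width (mat_product A \<omega> n)) \<longlonglongrightarrow> 0"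
    and V: "nonneg_vec V" "V \<noteq> 0"
  shows "convergent (\<lambda>n. normalize_vec (mat_product A \<omega> n *v V))"
proof (rule convergent_vec)
  fix i
  let ?P = "\<lambda>n. mat_product A \<omega> n" and ?x = "\<lambda>n. normalize_vec (mat_product A \<omega> n *v V) $ i"
  have close: "\<bar>?x n - ?x m\<bar> \<le> cone_width (?P m)" if "m \<le> n" for m n
  proof -
    define Q where "Q = mat_product A (\<lambda>i. \<omega> (m + i)) (n - m)"
    have Q: "nonneg_mat Q" "det Q \<noteq> 0"
      using nonneg_mat_product[of A "\<lambda>i. \<omega> (m + i)"] det_mat_product_nonzero[of A "\<lambda>i. \<omega> (m + i)"]
      by (simp_all add: Q_def nonneg inv)
    have "?P n *v V = ?P m *v (Q *v V)"
      using mat_product_append[of A \<omega> m "n - m"] that by (simp add: Q_def matrix_vector_mul_assoc)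
    then show ?thesis
      using normalize_vec_diff_le_cone_width[of "?P m" "Q *v V" V i]
        nonneg_mat_product[of A \<omega>, OF nonneg] det_mat_product_nonzero[of A \<omega>, OF inv]
        nonneg_vec_mult[OF Q(1) V(1)] mult_nonzero_of_det[OF Q(2) V(2)] V by simp
  qed
  have "Cauchy ?x"
  proof (rule metric_CauchyI)
    fix e :: real assume "0 < e"
    then have "\<forall>\<^sub>F n in sequentially. cone_width (?P n) < e / 2"
      using order_tendstoD(2)[OF width, of "e / 2"] by simp
    then obtain m where m: "cone_width (?P m) < e / 2" by (auto simp: eventually_sequentially)
    have "dist (?x n) (?x n') < e" if "n \<ge> m" "n' \<ge> m" for n n'
      using close[OF that(1)] close[OF that(2)] m unfolding dist_real_def by linarith
    then show "\<exists>M. \<forall>n\<ge>M. \<forall>n'\<ge>M. dist (?x n) (?x n') < e" by blast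
  qed
  then show "convergent ?x" by (simp add: Cauchy_convergent_iff)
qed

lemma cone_width_tendsto_0:
  assumes nonneg: "\<And>i. nonneg_mat (A (\<omega> i))" and inv: "\<And>i. det (A (\<omega> i)) \<noteq> 0"
    and pos: "\<And>i j. 0 < (A a ** A b ** A c) $ i $ j"
    and inf: "\<exists>\<^sub>\<infinity>n. \<exists>h. map \<omega> [0..<n] = h @ [a, b, c]"
  shows "(\<lambda>n. cone_width (mat_product A \<omega> n)) \<longlonglongrightarrow> 0"
proof (rule contraction_tendsto_0)
  let ?P = "\<lambda>n. mat_product A \<omega> n" and ?W = "A a ** A b ** A c"
  note P = nonneg_mat_product[of A \<omega>, OF nonneg] det_mat_product_nonzero[of A \<omega>, OF inv]
  show "0 \<le> cone_width (?P n)" for n by (rule cone_width_nonneg)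
  show "decseq (\<lambda>n. cone_width (?P n))"
  proof (rule decseq_SucI)
    fix n
    have "cone_width (?P (Suc n)) \<le> contraction_coeff (A (\<omega> n)) * cone_width (?P n)"
      unfolding mat_product.simps by (intro cone_width_mult_le P nonneg inv)
    also have "\<dots> \<le> 1 * cone_width (?P n)"
      by (intro mult_right_mono contraction_coeff_le_1 nonneg inv cone_width_nonneg)
    finally show "cone_width (?P (Suc n)) \<le> cone_width (?P n)" by simp
  qed
  show "contraction_coeff ?W < 1" by (rule contraction_coeff_less_1[OF pos])
  show "\<exists>\<^sub>\<infinity>n. \<exists>m\<le>n. m + 3 \<ge> n \<and> cone_width (?P n) \<le> contraction_coeff ?W * cone_width (?P m)"
    using inf
  proof (rule INFM_mono)
    fix n assume "\<exists>h. map \<omega> [0..<n] = h @ [a, b, c]"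
    then obtain h where h: "map \<omega> [0..<n] = h @ [a, b, c]" by blast
    have n: "n = length h + 3" using arg_cong[OF h, of length] by simp
    have \<omega>: "\<omega> (length h) = a" "\<omega> (Suc (length h)) = b" "\<omega> (Suc (Suc (length h))) = c"
      using h[unfolded n] by (simp_all add: numeral_3_eq_3)
    have Pn: "?P n = ?P (length h) ** ?W"
      unfolding n numeral_3_eq_3 by (simp add: \<omega> matrix_mul_assoc)
    have "nonneg_mat ?W" "det ?W \<noteq> 0"
      using nonneg inv \<omega> by (metis nonneg_mat_mult, metis det_mul mult_eq_0_iff)
    then have "cone_width (?P n) \<le> contraction_coeff ?W * cone_width (?P (length h))"
      unfolding Pn by (intro cone_width_mult_le P)
    then show "\<exists>m\<le>n. m + 3 \<ge> n \<and> cone_width (?P n) \<le> contraction_coeff ?W * cone_width (?P m)"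
      using n by (intro exI[of _ "length h"]) simp
  qed
qed

lemma det_tendsto_0_of_cone_width:
  assumes inv: "\<And>i. det (A (\<omega> i)) \<noteq> 0"
    and width: "(\<lambda>n. cone_width (mat_product A \<omega> n)) \<longlonglongrightarrow> 0"
  shows "(\<lambda>n. det (normalize_mat (mat_product A \<omega> n))) \<longlonglongrightarrow> 0"
proof (rule Lim_null_comparison[OF always_eventually width], rule allI)
  fix n
  show "norm (det (normalize_mat (mat_product A \<omega> n))) \<le> cone_width (mat_product A \<omega> n)"
    using det_normalize_le_cone_width[OF det_mat_product_nonzero[of A \<omega>, OF inv]] by simp
qed

section \<open>A positive word or a common triangular form\<close>

lemma diagonal_formI:
  assumes "M $ 1 $ 2 = 0" "M $ 2 $ 1 = 0" "det M \<noteq> 0"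
  shows "diagonal_form M"
  unfolding diagonal_form_def
  using assms by (intro exI[of _ "M $ 1 $ 1"] exI[of _ "M $ 2 $ 2"]) (auto simp: det_2 vec_eq_iff forall_2)

lemma antidiagonal_formI:
  assumes "M $ 1 $ 1 = 0" "M $ 2 $ 2 = 0" "det M \<noteq> 0"
  shows "antidiagonal_form M"
  unfolding antidiagonal_form_def
  using assms by (intro exI[of _ "M $ 1 $ 2"] exI[of _ "M $ 2 $ 1"]) (auto simp: det_2 vec_eq_iff forall_2)

lemma triple_product_pos:
  fixes P Q R :: "real^'n^'n"
  assumes nonneg: "\<And>x y. 0 \<le> P $ x $ y" "\<And>x y. 0 \<le> Q $ x $ y" "\<And>x y. 0 \<le> R $ x $ y"
    and pos: "0 < P $ x $ i" "0 < Q $ i $ j" "0 < R $ j $ y"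
  shows "0 < (P ** Q ** R) $ x $ y"
proof -
  have "0 < (\<Sum>a\<in>UNIV. P $ x $ a * Q $ a $ j)"
    using assms by (intro sum_pos2[of _ i]) auto
  then have "0 < (\<Sum>b\<in>UNIV. (\<Sum>a\<in>UNIV. P $ x $ a * Q $ a $ b) * R $ b $ y)"
    using assms by (intro sum_pos2[of _ j]) (auto intro!: sum_nonneg mult_nonneg_nonneg)
  then show ?thesis by (simp add: matrix_matrix_mult_def)
qed

text \<open>Being invertible and not of one of the two excluded forms, \<open>A k0\<close> has at least three positive entries. If both
off-diagonal entries are positive, then so is its cube. Otherwise its only zero is at \<open>(j, i)\<close> with
\<open>i \<noteq> j\<close>, so its column \<open>j\<close> and its row \<open>i\<close> are positive. A matrix whose entry at \<open>(j, i)\<close> is positive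
gives a positive product when it is placed between two copies of \<open>A k0\<close>; if there is none, all
matrices have the same triangular form.\<close>

lemma positive_sandwich_or_triangular:
  assumes nonneg: "\<And>k. k \<in> K \<Longrightarrow> nonneg_mat (A k)" and inv: "\<And>k. k \<in> K \<Longrightarrow> det (A k) \<noteq> 0"
    and k0: "k0 \<in> K" "\<not> diagonal_form (A k0)" "\<not> antidiagonal_form (A k0)"
  obtains (positive) k where "k \<in> K" "\<And>i j. 0 < (A k0 ** A k ** A k0) $ i $ j"
  | (triangular) i j where "i \<noteq> j" "\<And>k. k \<in> K \<Longrightarrow> A k $ j $ i = 0" "0 < A k0 $ i $ j"
proof -
  have nn: "0 \<le> A k $ x $ y" if "k \<in> K" for k x y
    using nonneg[OF that] by (simp add: nonneg_mat_def)
  note nn0 = nn[OF k0(1)] and d0 = inv[OF k0(1)]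
  have off: "A k0 $ 1 $ 2 \<noteq> 0 \<or> A k0 $ 2 $ 1 \<noteq> 0"
    using diagonal_formI[of "A k0"] k0 d0 by blast
  have diag: "A k0 $ 1 $ 1 \<noteq> 0 \<or> A k0 $ 2 $ 2 \<noteq> 0"
    using antidiagonal_formI[of "A k0"] k0 d0 by blast
  have sandwich: thesis
    if "k \<in> K" "0 < A k $ i $ j" "\<And>x. 0 < A k0 $ x $ i" "\<And>y. 0 < A k0 $ j $ y" for k i j
    using that nn0 by (intro positive[of k] triple_product_pos[where i=i and j=j]) (auto intro: nn)
  show thesis
  proof (cases "0 < A k0 $ 1 $ 2 \<and> 0 < A k0 $ 2 $ 1")
    case True
    obtain i where i: "0 < A k0 $ i $ i" using diag nn0 by (metis less_le)
    have "0 < A k0 $ x $ i" "0 < A k0 $ i $ x" for x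
      using True i exhaust_2[of i] exhaust_2[of x] by auto
    with k0(1) i show thesis by (intro sandwich)
  next
    case False
    have diag: "0 < A k0 $ 1 $ 1" "0 < A k0 $ 2 $ 2"
      using False nn0[of 1 1] nn0[of 2 2] nn0[of 1 2] nn0[of 2 1] d0[unfolded det_2] by (auto simp: less_le)
    show thesis
    proof (cases "\<exists>i j k. i \<noteq> j \<and> 0 < A k0 $ i $ j \<and> k \<in> K \<and> A k $ j $ i \<noteq> 0")
      case True
      then obtain i j k where ijk: "i \<noteq> j" "0 < A k0 $ i $ j" "k \<in> K" "A k $ j $ i \<noteq> 0" by blast
      have b: "0 < A k $ j $ i" using ijk nn[of k j i] by (simp add: less_le)
      have "0 < A k0 $ x $ j" "0 < A k0 $ i $ x" for x
        using diag ijk exhaust_2[of i] exhaust_2[of j] exhaust_2[of x] by auto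
      with ijk(3) b show thesis by (intro sandwich)
    next
      case no: False
      from off have "0 < A k0 $ 1 $ 2 \<or> 0 < A k0 $ 2 $ 1"
        using nn0 by (auto simp: less_le)
      then show thesis
      proof
        assume "0 < A k0 $ 1 $ 2"
        then show thesis using no[simplified, rule_format, of 1 2] by (intro triangular[of 1 2]) auto
      next
        assume "0 < A k0 $ 2 $ 1"
        then show thesis using no[simplified, rule_format, of 2 1] by (intro triangular[of 2 1]) auto
      qed
    qed
  qed
qed

section \<open>Triangular factors\<close>

lemma incseq_convergent_or_at_top:
  fixes s :: "nat \<Rightarrow> real"
  assumes inc: "incseq s"
  shows "convergent s \<or> filterlim s at_top sequentially"
proof (cases "\<exists>B. \<forall>n. s n \<le> B")
  case True
  then show ?thesis using incseq_convergent[OF inc] unfolding convergent_def by metis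
next
  case False
  have "\<exists>N. \<forall>n\<ge>N. B \<le> s n" for B
  proof -
    obtain N where "B < s N" using False by (meson not_le)
    then have "\<forall>n\<ge>N. B \<le> s n" using inc by (meson incseqD less_imp_le order_trans)
    then show ?thesis by blast
  qed
  then show ?thesis by (simp add: filterlim_at_top eventually_sequentially)
qed

lemma mult_entry_2:
  fixes P Q :: "real^2^2"
  assumes "i \<noteq> j"
  shows "(P ** Q) $ x $ y = P $ x $ i * Q $ i $ y + P $ x $ j * Q $ j $ y"
  by (simp add: matrix_matrix_mult_def sum_UNIV_2_of_neq[OF assms])

text \<open>With \<open>i = 1\<close> and \<open>j = 2\<close> the factors are upper triangular; the opposite choice covers the lower
triangular ones.\<close>

locale triangular_sequence =
  fixes A :: "nat \<Rightarrow> real^2^2" and \<omega> :: "nat \<Rightarrow> nat" and i j :: 2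
  assumes ij: "i \<noteq> j"
    and nonneg: "\<And>n. nonneg_mat (A (\<omega> n))"
    and inv: "\<And>n. det (A (\<omega> n)) \<noteq> 0"
    and zero: "\<And>n. A (\<omega> n) $ j $ i = 0"
begin

abbreviation P :: "nat \<Rightarrow> real^2^2" where "P n \<equiv> mat_product A \<omega> n"

text \<open>On vectors with entry \<open>t\<close> at \<open>i\<close> and \<open>1\<close> at \<open>j\<close> the product acts, up to scaling, by
\<open>t \<mapsto> ratio n * t + slope n\<close>. The ratio is a multiplicative random walk and the slope is the sum of
its values weighted by the shears of the factors.\<close>

definition ratio :: "nat \<Rightarrow> real" where "ratio n = P n $ i $ i / P n $ j $ j"
definition slope :: "nat \<Rightarrow> real" where "slope n = P n $ i $ j / P n $ j $ j"

lemma factor_nonneg: "0 \<le> A (\<omega> n) $ x $ y"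
  using nonneg[of n] by (simp add: nonneg_mat_def)

lemma factor_diagonal_pos: "0 < A (\<omega> n) $ i $ i" "0 < A (\<omega> n) $ j $ j"
  using inv[of n] det_2_triangular[OF ij zero[of n]] factor_nonneg[of n] by (auto simp: less_le)

lemma product_zero: "P n $ j $ i = 0"
  by (induction n) (use ij in \<open>auto simp: mat_def mult_entry_2[OF ij] zero\<close>)

lemma product_diagonal_pos: "0 < P n $ i $ i" "0 < P n $ j $ j"
proof (induction n)
  case (Suc n)
  show "0 < P (Suc n) $ i $ i" "0 < P (Suc n) $ j $ j"
    using Suc factor_diagonal_pos[of n] by (simp_all add: mult_entry_2[OF ij] zero product_zero)
qed (auto simp: mat_def)

lemma product_nonneg: "0 \<le> P n $ x $ y"
  using nonneg_mat_product[of A \<omega> n] nonneg by (simp add: nonneg_mat_def)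

lemma ratio_pos: "0 < ratio n"
  using product_diagonal_pos[of n] by (simp add: ratio_def)

lemma slope_nonneg: "0 \<le> slope n"
  using product_diagonal_pos[of n] product_nonneg by (simp add: slope_def)

lemma slope_Suc: "slope (Suc n) = slope n + ratio n * (A (\<omega> n) $ i $ j / A (\<omega> n) $ j $ j)"
  using product_diagonal_pos[of n] factor_diagonal_pos[of n]
  by (simp add: slope_def ratio_def mult_entry_2[OF ij] product_zero field_simps)

lemma incseq_slope: "incseq slope"
proof (rule incseq_SucI)
  fix n
  show "slope n \<le> slope (Suc n)"
    using ratio_pos[of n] factor_nonneg[of n i j] factor_diagonal_pos(2)[of n]
    by (simp add: slope_Suc)
qed

text \<open>The determinant is the product of the diagonal entries, and the squared norm is compared with
the square of the \<open>(j, j)\<close> entry, or with the product of the two entries in row \<open>i\<close>.\<close>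

lemma det_normalize_le:
  "\<bar>det (normalize_mat (P n))\<bar> \<le> ratio n" "0 < slope n \<Longrightarrow> \<bar>det (normalize_mat (P n))\<bar> \<le> 1 / slope n"
proof -
  define N where "N = matrix_norm1 (P n)"
  have le: "P n $ x $ y \<le> N" for x y
    using entry_le_matrix_norm1[of "P n" x y] unfolding N_def by linarith
  have N: "0 < N" using le[of i i] product_diagonal_pos[of n] by linarith
  have det: "\<bar>det (normalize_mat (P n))\<bar> = P n $ i $ i * P n $ j $ j / (N * N)"
    using det_2_triangular[OF ij product_zero[of n]] product_diagonal_pos[of n]
    by (simp add: det_normalize_mat N_def power2_eq_square)
  have "P n $ i $ i * P n $ j $ j / (N * N) \<le> P n $ i $ i * P n $ j $ j / (P n $ j $ j * P n $ j $ j)"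
    using product_diagonal_pos[of n] N le by (intro frac_le mult_mono) auto
  then show "\<bar>det (normalize_mat (P n))\<bar> \<le> ratio n"
    using product_diagonal_pos[of n] by (simp add: det ratio_def)
  assume "0 < slope n"
  then have b: "0 < P n $ i $ j" using product_diagonal_pos[of n] by (simp add: slope_def zero_less_divide_iff)
  have "P n $ i $ i * P n $ j $ j / (N * N) \<le> P n $ i $ i * P n $ j $ j / (P n $ i $ i * P n $ i $ j)"
    using product_diagonal_pos[of n] N le b by (intro frac_le mult_mono) auto
  then show "\<bar>det (normalize_mat (P n))\<bar> \<le> 1 / slope n"
    using product_diagonal_pos[of n] by (simp add: det slope_def)
qed

lemma normalize_vec_triangular:
  assumes V: "nonneg_vec V"
  shows "V $ j = 0 \<Longrightarrow> 0 < V $ i \<Longrightarrow> normalize_vec (P n *v V) = axis i 1"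
    and "0 < V $ j \<Longrightarrow> normalize_vec (P n *v V) =
      (\<chi> k. if k = j then 1 / (1 + (ratio n * (V $ i / V $ j) + slope n))
            else 1 - 1 / (1 + (ratio n * (V $ i / V $ j) + slope n)))"
proof -
  note d = product_diagonal_pos[of n]
  have two: "(\<forall>k. Q k) \<longleftrightarrow> Q i \<and> Q j" for Q :: "2 \<Rightarrow> bool"
    using ij forall_2[of Q] exhaust_2[of i] exhaust_2[of j] by auto
  have PV: "(P n *v V) $ i = P n $ i $ i * V $ i + P n $ i $ j * V $ j" "(P n *v V) $ j = P n $ j $ j * V $ j"
    by (simp_all add: matrix_vector_mult_def sum_UNIV_2_of_neq[OF ij] product_zero)
  have nn: "nonneg_vec (P n *v V)"
    using V nonneg_mat_product[of A \<omega>, OF nonneg] by (rule nonneg_vec_mult[rotated])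
  then have norm: "norm1 (P n *v V) = (P n *v V) $ i + (P n *v V) $ j"
    by (simp add: norm1_def sum_UNIV_2_of_neq[OF ij] nonneg_vec_def)
  {
    assume "V $ j = 0" "0 < V $ i"
    then show "normalize_vec (P n *v V) = axis i 1"
      using d ij unfolding vec_eq_iff by (subst two) (simp add: normalize_vec_def norm PV axis_def)
  }
  assume Vj: "0 < V $ j"
  define y where "y = ratio n * (V $ i / V $ j) + slope n"
  have y: "0 \<le> y" "(P n *v V) $ i = y * (P n *v V) $ j"
    using V Vj d ratio_pos[of n] slope_nonneg[of n]
    by (simp add: y_def nonneg_vec_def, simp add: y_def ratio_def slope_def PV field_simps)
  have z: "0 < (P n *v V) $ j" using d Vj by (simp add: PV)
  have sum: "(P n *v V) $ i + (P n *v V) $ j = (1 + y) * (P n *v V) $ j"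
    unfolding y(2) by (simp add: algebra_simps)
  then have "normalize_vec (P n *v V) $ j = 1 / (1 + y)" "normalize_vec (P n *v V) $ i = 1 - 1 / (1 + y)"
    using y(1) z unfolding normalize_vec_def norm sum by (simp_all add: y(2), simp add: field_simps)
  then show "normalize_vec (P n *v V) =
      (\<chi> k. if k = j then 1 / (1 + (ratio n * (V $ i / V $ j) + slope n))
            else 1 - 1 / (1 + (ratio n * (V $ i / V $ j) + slope n)))"
    using ij unfolding vec_eq_iff y_def[symmetric] by (subst two) simp
qed

text \<open>The assumption on visits holds for almost every sequence by the conditional Borel-Cantelli
lemma.\<close>

context
  fixes k0 :: nat
  assumes k0: "0 < A k0 $ i $ j"
    and visits: "\<And>e. (\<exists>\<^sub>\<infinity>n. inverse (real (Suc e)) \<le> ratio n) \<Longrightarrow>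
      (\<exists>\<^sub>\<infinity>n. inverse (real (Suc e)) \<le> ratio n \<and> \<omega> n = k0)"
begin

text \<open>Whenever the ratio is at least \<open>\<epsilon>\<close> and the next letter is \<open>k0\<close>, the slope grows by a fixed
amount. If the slope stays bounded this happens finitely often, hence the ratio exceeds each
\<open>\<epsilon>\<close> only finitely often.\<close>

lemma slope_at_top_or_ratio_tendsto_0:
  "filterlim slope at_top sequentially \<or> (ratio \<longlonglongrightarrow> 0 \<and> convergent slope)"
proof (cases "filterlim slope at_top sequentially")
  case False
  then have conv: "convergent slope" using incseq_convergent_or_at_top[OF incseq_slope] by blast
  then obtain l where l: "slope \<longlonglongrightarrow> l" by (auto simp: convergent_def)
  have "(\<lambda>n. slope (Suc n) - slope n) \<longlonglongrightarrow> l - l" by (intro tendsto_diff l LIMSEQ_Suc)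
  then have incr: "(\<lambda>n. slope (Suc n) - slope n) \<longlonglongrightarrow> 0" by simp
  have small: "\<forall>\<^sub>F n in sequentially. ratio n < inverse (real (Suc e))" for e
  proof (rule ccontr)
    assume "\<not> (\<forall>\<^sub>F n in sequentially. ratio n < inverse (real (Suc e)))"
    then have inf: "\<exists>\<^sub>\<infinity>n. inverse (real (Suc e)) \<le> ratio n \<and> \<omega> n = k0"
      by (intro visits) (simp add: frequently_def cofinite_eq_sequentially not_le)
    then obtain n0 where n0: "\<omega> n0 = k0" by (auto dest: INFM_EX)
    define c where "c = inverse (real (Suc e)) * (A k0 $ i $ j / A k0 $ j $ j)"
    have "0 < c" using k0 factor_diagonal_pos[of n0] by (simp add: c_def n0)
    then have "\<forall>\<^sub>F n in sequentially. slope (Suc n) - slope n < c"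
      by (rule order_tendstoD(2)[OF incr])
    then obtain N where N: "\<And>n. n \<ge> N \<Longrightarrow> slope (Suc n) - slope n < c"
      by (auto simp: eventually_sequentially)
    obtain n where n: "n \<ge> N" "inverse (real (Suc e)) \<le> ratio n" "\<omega> n = k0"
      using inf unfolding INFM_nat_le by blast
    have "c \<le> ratio n * (A k0 $ i $ j / A k0 $ j $ j)"
      unfolding c_def using n k0 factor_diagonal_pos[of n] by (intro mult_right_mono) auto
    also have "\<dots> = slope (Suc n) - slope n" by (simp add: slope_Suc n)
    finally show False using N[OF n(1)] by linarith
  qed
  have "ratio \<longlonglongrightarrow> 0"
  proof (rule tendstoI)
    fix r :: real assume "0 < r"
    then obtain e where e: "inverse (real (Suc e)) < r" using reals_Archimedean by blast
    show "\<forall>\<^sub>F n in sequentially. dist (ratio n) 0 < r"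
      using small[of e]
    proof eventually_elim
      case (elim n)
      then show ?case using e ratio_pos[of n] by (simp add: dist_real_def)
    qed
  qed
  with conv show ?thesis by blast
qed blast

lemma det_normalize_tendsto_0: "(\<lambda>n. det (normalize_mat (P n))) \<longlonglongrightarrow> 0"
  using slope_at_top_or_ratio_tendsto_0
proof
  assume top: "filterlim slope at_top sequentially"
  then have "\<forall>\<^sub>F n in sequentially. 0 < slope n" by (simp add: filterlim_at_top_dense)
  then have bound: "\<forall>\<^sub>F n in sequentially. norm (det (normalize_mat (P n))) \<le> 1 / slope n"
    by eventually_elim (simp add: det_normalize_le)
  have "(\<lambda>n. 1 / slope n) \<longlonglongrightarrow> 0"
    by (rule real_tendsto_divide_at_top[OF tendsto_const top])
  with bound show ?thesis by (rule Lim_null_comparison)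
next
  assume "ratio \<longlonglongrightarrow> 0 \<and> convergent slope"
  then show ?thesis
    using Lim_null_comparison[of "\<lambda>n. det (normalize_mat (P n))" ratio sequentially] det_normalize_le(1)
    by (simp add: always_eventually)
qed

lemma convergent_normalize_vec:
  assumes V: "nonneg_vec V" "V \<noteq> 0"
  shows "convergent (\<lambda>n. normalize_vec (P n *v V))"
proof (cases "V $ j = 0")
  case True
  have "V $ i \<noteq> 0"
  proof
    assume "V $ i = 0"
    with True have "V $ 1 = 0 \<and> V $ 2 = 0" using ij exhaust_2[of i] exhaust_2[of j] by auto
    with V(2) show False by (simp add: vec_eq_iff forall_2)
  qed
  then have "0 < V $ i" using V by (simp add: nonneg_vec_def less_le)
  then show ?thesis using True V by (simp add: normalize_vec_triangular(1) convergent_const)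
next
  case False
  then have Vj: "0 < V $ j" and c: "0 \<le> V $ i / V $ j" using V by (simp_all add: nonneg_vec_def less_le)
  define y where "y n = ratio n * (V $ i / V $ j) + slope n" for n
  have y0: "0 \<le> y n" for n 
    unfolding y_def by (intro add_nonneg_nonneg mult_nonneg_nonneg c slope_nonneg less_imp_le[OF ratio_pos])
  have "convergent (\<lambda>n. 1 / (1 + y n))"
    using slope_at_top_or_ratio_tendsto_0
  proof
    assume top: "filterlim slope at_top sequentially"
    have "filterlim (\<lambda>n. 1 + y n) at_top sequentially"
    proof (rule filterlim_at_top_mono[OF top always_eventually], rule allI)
      fix n show "slope n \<le> 1 + y n" 
        using mult_nonneg_nonneg[OF less_imp_le[OF ratio_pos[of n]] c] unfolding y_def by linarith
    qed
    then have "(\<lambda>n. 1 / (1 + y n)) \<longlonglongrightarrow> 0"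
      by (rule real_tendsto_divide_at_top[OF tendsto_const])
    then show ?thesis by (rule convergentI)
  next
    assume lim: "ratio \<longlonglongrightarrow> 0 \<and> convergent slope"
    then obtain l where l: "slope \<longlonglongrightarrow> l" by (auto simp: convergent_def)
    have y: "y \<longlonglongrightarrow> 0 * (V $ i / V $ j) + l"
      unfolding y_def using lim l by (intro tendsto_intros) auto
    then have "0 \<le> 0 * (V $ i / V $ j) + l"
      using y0 by (intro LIMSEQ_le_const[OF y]) auto
    then have "(\<lambda>n. 1 / (1 + y n)) \<longlonglongrightarrow> 1 / (1 + (0 * (V $ i / V $ j) + l))"
      by (intro tendsto_intros y) simp
    then show ?thesis by (rule convergentI)
  qed
  then obtain z where z: "(\<lambda>n. 1 / (1 + y n)) \<longlonglongrightarrow> z" by (auto simp: convergent_def)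
  show ?thesis
  proof (rule convergent_vec)
    fix k
    have "(\<lambda>n. normalize_vec (P n *v V) $ k) \<longlonglongrightarrow> (if k = j then z else 1 - z)"
      unfolding normalize_vec_triangular(2)[OF V(1) Vj] y_def[symmetric] using z
      by (auto intro!: tendsto_intros)
    then show "convergent (\<lambda>n. normalize_vec (P n *v V) $ k)" by (rule convergentI)
  qed
qed

end

end

section \<open>Almost sure behaviour\<close>

lemma prob_space_letters:
  assumes "random_product_setting s A p"
  shows "prob_space (point_measure {..<s} (\<lambda>k. ennreal (p k)))"
proof (rule prob_spaceI)
  have "emeasure (point_measure {..<s} (\<lambda>k. ennreal (p k))) {..<s} = (\<Sum>k<s. ennreal (p k))"
    by (simp add: emeasure_point_measure_finite)
  also have "\<dots> = ennreal (\<Sum>k<s. p k)"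
    using assms by (intro sum_ennreal) (auto simp: random_product_setting_def less_imp_le)
  finally show "emeasure (point_measure {..<s} (\<lambda>k. ennreal (p k))) (space (point_measure {..<s} (\<lambda>k. ennreal (p k)))) = 1"
    using assms by (simp add: random_product_setting_def space_point_measure)
qed

lemma measure_letter_pos:
  assumes "random_product_setting s A p" "k < s"
  shows "0 < measure (point_measure {..<s} (\<lambda>k. ennreal (p k))) {k}"
proof -
  have "0 < p k" using assms by (simp add: random_product_setting_def)
  then show ?thesis using assms(2) by (simp add: measure_def emeasure_point_measure_finite)
qed

lemma AE_letters_less: "AE \<omega> in product_prob s p. \<forall>n. \<omega> n < s"
  unfolding product_prob_def by (rule AE_I2) (auto simp: space_PiM space_point_measure)

lemma AE_letter_visits:
  assumes "random_product_setting s A p" "k < s"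
  shows "AE \<omega> in product_prob s p.
    (\<exists>\<^sub>\<infinity>n. G (map \<omega> [0..<n])) \<longrightarrow> (\<exists>\<^sub>\<infinity>n. G (map \<omega> [0..<n]) \<and> \<omega> n = k)"
  unfolding product_prob_def
  by (rule AE_infinitely_often_letter[OF prob_space_letters[OF assms(1)] _ measure_letter_pos[OF assms]])
     (simp add: sets_point_measure space_point_measure)

lemma AE_word_visits:
  assumes "random_product_setting s A p" "set w \<subseteq> {..<s}"
  shows "AE \<omega> in product_prob s p. \<exists>\<^sub>\<infinity>n. \<exists>h. map \<omega> [0..<n] = h @ w"
  unfolding product_prob_def
  using assms(2)
  by (intro AE_infinitely_often_word[OF prob_space_letters[OF assms(1)]] measure_letter_pos[OF assms(1)])
     (auto simp: sets_point_measure space_point_measure)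

text \<open>In each of the three cases almost every sequence visits the letters that its argument needs:
a singular letter once, a word with a positive product infinitely often, or a letter with a nonzero
shear at infinitely many of the times when the random walk is large.\<close>

theorem AE_limit_behaviour:
  assumes set: "random_product_setting s A p" and nm: "some_not_monomial s A"
  shows "AE \<omega> in product_prob s p.
    (\<lambda>n. det (normalize_mat (mat_product A \<omega> n))) \<longlonglongrightarrow> 0 \<and>
    (\<forall>V. nonneg_vec V \<longrightarrow> (\<forall>n. mat_product A \<omega> n *v V \<noteq> 0) \<longrightarrow>
       convergent (\<lambda>n. normalize_vec (mat_product A \<omega> n *v V)))"
proof -
  have nonneg: "\<And>k. k \<in> {..<s} \<Longrightarrow> nonneg_mat (A k)"
    using set by (simp add: random_product_setting_def)
  show ?thesis
  proof (cases "\<exists>k<s. det (A k) = 0")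
    case True
    then obtain k where k: "k < s" "det (A k) = 0" by blast
    have "AE \<omega> in product_prob s p. \<exists>\<^sub>\<infinity>n. \<exists>h. map \<omega> [0..<n] = h @ [k]"
      using k by (intro AE_word_visits[OF set]) auto
    with AE_letters_less show ?thesis
    proof eventually_elim
      case (elim \<omega>)
      then obtain n h where "map \<omega> [0..<n] = h @ [k]" by (auto dest: INFM_EX)
      then have "det (mat_product A \<omega> n) = 0"
        by (simp add: mat_product_eq_word_product det_mul k)
      then show ?case
        using convergent_of_singular[of A \<omega>] nonneg elim(1)
        by (auto intro: det_tendsto_0_of_singular)
    qed
  next
    case False
    then have inv: "\<And>k. k \<in> {..<s} \<Longrightarrow> det (A k) \<noteq> 0" by auto
    obtain k0 where k0: "k0 \<in> {..<s}" "\<not> diagonal_form (A k0)" "\<not> antidiagonal_form (A k0)"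
      using nm by (auto simp: some_not_monomial_def)
    consider (positive) k where "k \<in> {..<s}" "\<And>i j. 0 < (A k0 ** A k ** A k0) $ i $ j"
      | (triangular) i j where "i \<noteq> j" "\<And>k. k \<in> {..<s} \<Longrightarrow> A k $ j $ i = 0" "0 < A k0 $ i $ j"
      by (rule positive_sandwich_or_triangular[where A = A and K = "{..<s}", OF nonneg inv k0]) blast+
    then show ?thesis
    proof cases
      case (positive k)
      have "AE \<omega> in product_prob s p. \<exists>\<^sub>\<infinity>n. \<exists>h. map \<omega> [0..<n] = h @ [k0, k, k0]"
        using k0(1) positive(1) by (intro AE_word_visits[OF set]) auto
      with AE_letters_less show ?thesis
      proof eventually_elim
        case (elim \<omega>)
        have \<omega>: "\<And>i. nonneg_mat (A (\<omega> i))" "\<And>i. det (A (\<omega> i)) \<noteq> 0"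
          using elim(1) nonneg inv by auto
        have width: "(\<lambda>n. cone_width (mat_product A \<omega> n)) \<longlonglongrightarrow> 0"
          by (rule cone_width_tendsto_0[where A=A and \<omega>=\<omega>, OF \<omega> positive(2) elim(2)])
        show ?case
        proof (intro conjI allI impI)
          show "(\<lambda>n. det (normalize_mat (mat_product A \<omega> n))) \<longlonglongrightarrow> 0"
            by (rule det_tendsto_0_of_cone_width[where A=A and \<omega>=\<omega>, OF \<omega>(2) width])
          fix V assume "nonneg_vec V" "\<forall>n. mat_product A \<omega> n *v V \<noteq> 0"
          moreover from this have "V \<noteq> 0" by auto
          ultimately show "convergent (\<lambda>n. normalize_vec (mat_product A \<omega> n *v V))"
            by (intro convergent_of_cone_width[where A=A and \<omega>=\<omega>, OF \<omega> width])
        qed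
      qed
    next
      case (triangular i j)
      let ?G = "\<lambda>e h. inverse (real (Suc e)) \<le> word_product A h $ i $ i / word_product A h $ j $ j"
      have "AE \<omega> in product_prob s p. \<forall>e. (\<exists>\<^sub>\<infinity>n. ?G e (map \<omega> [0..<n])) \<longrightarrow>
          (\<exists>\<^sub>\<infinity>n. ?G e (map \<omega> [0..<n]) \<and> \<omega> n = k0)"
        unfolding AE_all_countable using k0(1)
        by (intro allI AE_letter_visits[OF set]) simp
      with AE_letters_less show ?thesis
      proof eventually_elim
        case (elim \<omega>)
        interpret triangular_sequence A \<omega> i j
          using elim(1) nonneg inv triangular by unfold_locales auto
        have visits: "\<exists>\<^sub>\<infinity>n. inverse (real (Suc e)) \<le> ratio n \<and> \<omega> n = k0"
          if "\<exists>\<^sub>\<infinity>n. inverse (real (Suc e)) \<le> ratio n" for e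
          using elim(2) that unfolding ratio_def mat_product_eq_word_product by blast
        show ?case
        proof (intro conjI allI impI)
          show "(\<lambda>n. det (normalize_mat (mat_product A \<omega> n))) \<longlonglongrightarrow> 0"
            by (rule det_normalize_tendsto_0[OF triangular(3) visits])
          fix V assume "nonneg_vec V" "\<forall>n. mat_product A \<omega> n *v V \<noteq> 0"
          moreover from this have "V \<noteq> 0" by auto
          ultimately show "convergent (\<lambda>n. normalize_vec (mat_product A \<omega> n *v V))"
            by (intro convergent_normalize_vec[OF triangular(3) visits])
        qed
      qed
    qed
  qed
qed

section \<open>Powers of a single matrix as examples\<close>

text \<open>With one letter the product space has a single point and the products are powers of one
matrix, so the examples are deterministic.\<close>

lemma AE_single_letter: "AE \<omega> in product_prob 1 p. \<omega> = (\<lambda>_. 0)"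
  using AE_letters_less[of 1 p] by (rule AE_mp) (auto intro!: AE_I2)

lemma AE_single_letterI: "P (\<lambda>_. 0) \<Longrightarrow> AE \<omega> in product_prob 1 p. P \<omega>"
  using AE_single_letter[of p] by (rule AE_mp) (auto intro!: AE_I2)

definition powers :: "real^2^2 \<Rightarrow> nat \<Rightarrow> real^2^2" where
  "powers M n = mat_product (\<lambda>_. M) (\<lambda>_. 0) n"

lemma powers_simps [simp]: "powers M 0 = mat 1" "powers M (Suc n) = powers M n ** M"
  by (simp_all add: powers_def)

lemma single_matrix_setting:
  assumes "nonneg_mat M" "\<And>n. powers M n \<noteq> 0"
  shows "random_product_setting 1 (\<lambda>_. M) (\<lambda>_. 1)"
  unfolding random_product_setting_def using assms
  by (auto intro!: AE_single_letterI simp: powers_def)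

lemma single_matrix_not_monomial:
  assumes "M $ i $ j \<noteq> 0" "M $ i $ k \<noteq> 0" "j \<noteq> k"
  shows "some_not_monomial 1 (\<lambda>_. M)"
  using assms exhaust_2[of i] exhaust_2[of j] exhaust_2[of k]
  by (auto simp: some_not_monomial_def diagonal_form_def antidiagonal_form_def)

lemma powers_distinct_limits:
  "powers (vector [vector [1, 1], vector [0, 2]]) n = vector [vector [1, 2 ^ n - 1], vector [0, 2 ^ n]]"
  by (induction n) (simp_all add: vec_eq_iff forall_2 mat_def matrix_matrix_mult_def sum_2)

lemma powers_ones:
  "powers (vector [vector [1, 1], vector [1, 1]]) (Suc n) = vector [vector [2 ^ n, 2 ^ n], vector [2 ^ n, 2 ^ n]]"
  by (induction n) (simp_all add: vec_eq_iff forall_2 mat_def matrix_matrix_mult_def sum_2)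

lemma powers_shear:
  "powers (vector [vector [1, 1], vector [0, 1]]) n = vector [vector [1, real n], vector [0, 1]]"
  by (induction n) (simp_all add: vec_eq_iff forall_2 mat_def matrix_matrix_mult_def sum_2)

lemma exists_single_matrix:
  assumes M: "nonneg_mat M" "\<And>n. powers M n \<noteq> 0"
    and entries: "M $ i $ j \<noteq> 0" "M $ i $ k \<noteq> 0" "j \<noteq> k"
    and Q: "Q 1 (\<lambda>_. M) (\<lambda>_. 1)"
  shows "\<exists>s A p. random_product_setting s A p \<and> some_not_monomial s A \<and> inj_on A {..<s} \<and> Q s A p"
  using single_matrix_setting[OF M] single_matrix_not_monomial[OF entries] Q
  by (intro exI[of _ "1 :: nat"] exI[of _ "\<lambda>_. M"] exI[of _ "\<lambda>_. 1 :: real"]) (simp add: inj_on_def)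

text \<open>The eigenvalue \<open>2\<close> has eigenvector \<open>(1, 1)\<close>, which attracts every vector except the multiples of the
other eigenvector \<open>(1, 0)\<close>; and the latter is the first column of every power.\<close>

lemma exists_distinct_column_limits:
  "\<exists>s A p. random_product_setting s A p \<and> some_not_monomial s A \<and> inj_on A {..<s} \<and>
      (AE \<omega> in product_prob s p.
         (\<forall>n j. column j (mat_product A \<omega> n) \<noteq> 0) \<and>
         (\<exists>L1 L2. L1 \<noteq> L2 \<and>
            (\<lambda>n. normalize_vec (column 1 (mat_product A \<omega> n))) \<longlonglongrightarrow> L1 \<and>
            (\<lambda>n. normalize_vec (column 2 (mat_product A \<omega> n))) \<longlonglongrightarrow> L2))"
proof -
  let ?M = "vector [vector [1, 1], vector [0, 2]] :: real^2^2"
  have col: "column 1 (powers ?M n) = vector [1, 0]" "column 2 (powers ?M n) = vector [2 ^ n - 1, 2 ^ n]" for n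
    by (simp_all add: powers_distinct_limits column_def vec_eq_iff forall_2)
  have nz: "column j (powers ?M n) \<noteq> 0" for n j
    using exhaust_2[of j] col[of n] by (auto simp: vec_eq_iff forall_2)
  have "(\<lambda>n. 1 / (2 - (1 / 2) ^ n)) \<longlonglongrightarrow> 1 / (2 - 0 :: real)"
    by (intro tendsto_intros) simp_all
  then have lim: "(\<lambda>n. 1 / (2 - (1 / 2) ^ n)) \<longlonglongrightarrow> (1 / 2 :: real)" by simp
  have col2: "normalize_vec (column 2 (powers ?M n)) = vector [1 - 1 / (2 - (1 / 2) ^ n), 1 / (2 - (1 / 2) ^ n)]" for n
  proof -
    have "(1 :: real) \<le> 2 ^ n" by simp
    then have "2 * 2 ^ n - 1 \<noteq> (0 :: real)" "2 * 2 ^ n - 1 > (0 :: real)" by linarith+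
    then show ?thesis
      by (simp add: col normalize_vec_def norm1_def vec_eq_iff forall_2 sum_2 power_divide field_simps)
  qed
  show ?thesis
  proof (rule exists_single_matrix[where M = ?M and i = 1 and j = 1 and k = 2], goal_cases)
    case 1
    show ?case by (simp add: nonneg_mat_def forall_2)
  next
    case (2 n)
    show ?case using nz[of 1 n] by (auto simp: column_def vec_eq_iff)
  next
    case 6
    have "(\<lambda>n. normalize_vec (column 1 (powers ?M n))) \<longlonglongrightarrow> vector [1, 0]"
      by (simp add: col normalize_vec_def norm1_def sum_2)
    moreover have "(\<lambda>n. normalize_vec (column 2 (powers ?M n))) \<longlonglongrightarrow> vector [1 - 1 / 2, 1 / 2]"
    proof (rule vec_tendstoI)
      fix i :: 2
      show "(\<lambda>n. normalize_vec (column 2 (powers ?M n)) $ i) \<longlonglongrightarrow> vector [1 - 1 / 2, 1 / 2] $ i"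
        unfolding col2 using exhaust_2[of i] tendsto_diff[OF tendsto_const[of 1] lim] lim by auto
    qed
    moreover have "vector [1, 0] \<noteq> (vector [1 - 1 / 2, 1 / 2] :: real^2)"
      by (simp add: vec_eq_iff forall_2)
    ultimately show ?case
      using nz by (intro AE_single_letterI conjI allI) (auto simp: powers_def)
  qed auto
qed

text \<open>The all-ones matrix sends every nonzero nonnegative vector to a multiple of \<open>(1, 1)\<close>, so the
limit is reached after one step.\<close>

lemma exists_exponential:
  "\<exists>s A p. random_product_setting s A p \<and> some_not_monomial s A \<and> inj_on A {..<s} \<and>
      (\<forall>V. nonneg_vec V \<and> V \<noteq> 0 \<longrightarrow>
         (AE \<omega> in product_prob s p.
            (\<forall>n. mat_product A \<omega> n *v V \<noteq> 0) \<and>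
            exponential_rate (\<lambda>n. normalize_vec (mat_product A \<omega> n *v V))))"
proof -
  let ?M = "vector [vector [1, 1], vector [1, 1]] :: real^2^2"
  have entry: "0 < powers ?M (Suc n) $ i $ j" for n i j
    unfolding powers_ones using exhaust_2[of i] exhaust_2[of j] by auto
  show ?thesis
  proof (rule exists_single_matrix[where M = ?M and i = 1 and j = 1 and k = 2], goal_cases)
    case 1
    show ?case by (simp add: nonneg_mat_def forall_2)
  next
    case (2 n)
    show ?case
    proof (cases n)
      case 0
      then show ?thesis by (auto simp: vec_eq_iff forall_2 mat_def)
    next
      case (Suc m)
      then show ?thesis using entry[of m 1 1] by (metis less_irrefl zero_index)
    qed
  next
    case 6
    show ?case
    proof (intro allI impI AE_single_letterI, fold powers_def, elim conjE)
      fix V :: "real^2" assume V: "nonneg_vec V" "V \<noteq> 0"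
      let ?X = "\<lambda>n. normalize_vec (powers ?M n *v V)"
      have sum: "0 < V $ 1 + V $ 2" using V norm1_pos_iff[of V] by (simp add: norm1_nonneg_vec)
      have P: "powers ?M (Suc n) *v V = vector [2 ^ n * (V $ 1 + V $ 2), 2 ^ n * (V $ 1 + V $ 2)]" for n
        unfolding powers_ones
        by (simp add: vec_eq_iff forall_2 matrix_vector_mult_def sum_2 distrib_left)
      have nz: "powers ?M n *v V \<noteq> 0" for n
        using V(2) sum by (cases n) (auto simp: P vec_eq_iff forall_2 simp del: powers_simps(2))
      have X: "?X (Suc n) = vector [1 / 2, 1 / 2]" for n
        using sum unfolding P
        by (simp add: normalize_vec_def norm1_def vec_eq_iff forall_2 sum_2 abs_mult)
      have X0: "\<bar>?X 0 $ i - vector [1 / 2, 1 / 2] $ i\<bar> < 2" for i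
        using V sum exhaust_2[of i] spec[OF V(1)[unfolded nonneg_vec_def], of 1]
          spec[OF V(1)[unfolded nonneg_vec_def], of 2]
        by (auto simp: normalize_vec_def norm1_nonneg_vec abs_less_iff field_simps)
      have "?X \<longlonglongrightarrow> vector [1 / 2, 1 / 2]"
        by (rule LIMSEQ_imp_Suc) (simp only: X tendsto_const)
      moreover have "\<bar>?X n $ i - vector [1 / 2, 1 / 2] $ i\<bar> < 2 * (1 / 2) ^ n" for n i
      proof (cases n)
        case 0
        then show ?thesis using X0[of i] by simp
      next
        case (Suc m)
        then show ?thesis by (simp only: X) simp
      qed
      ultimately have "exponential_rate ?X"
        unfolding exponential_rate_def
        by (intro exI[of _ "vector [1 / 2, 1 / 2]"] conjI exI[of _ "2 :: real"] exI[of _ "1 / 2 :: real"]) auto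
      with nz show "(\<forall>n. powers ?M n *v V \<noteq> 0) \<and> exponential_rate ?X" by blast
    qed
  qed auto
qed

text \<open>The powers of the unipotent shear send \<open>(0, 1)\<close> to \<open>(n, 1)\<close>, whose direction approaches
\<open>(1, 0)\<close> only at the rate \<open>1 / (n + 1)\<close>.\<close>

lemma exists_not_exponential:
  "\<exists>s A p. random_product_setting s A p \<and> some_not_monomial s A \<and> inj_on A {..<s} \<and>
      (\<exists>V. nonneg_vec V \<and>
         (AE \<omega> in product_prob s p.
            (\<forall>n. mat_product A \<omega> n *v V \<noteq> 0) \<and>
            convergent (\<lambda>n. normalize_vec (mat_product A \<omega> n *v V)) \<and>
            \<not> exponential_rate (\<lambda>n. normalize_vec (mat_product A \<omega> n *v V))))"
proof -
  let ?M = "vector [vector [1, 1], vector [0, 1]] :: real^2^2" and ?V = "vector [0, 1] :: real^2"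
  let ?X = "\<lambda>n. normalize_vec (powers ?M n *v ?V)"
  have P: "powers ?M n *v ?V = vector [real n, 1]" for n
    by (simp add: powers_shear vec_eq_iff forall_2 matrix_vector_mult_def sum_2)
  have nz: "powers ?M n *v ?V \<noteq> 0" for n
    by (simp add: P vec_eq_iff forall_2)
  have X: "?X n = vector [1 - inverse (real (Suc n)), inverse (real (Suc n))]" for n
  proof -
    have "1 / (1 + real n) * real n = 1 - inverse (1 + real n)" by (simp add: divide_simps)
    then show ?thesis
      by (simp add: P normalize_vec_def norm1_def vec_eq_iff forall_2 sum_2 add.commute inverse_eq_divide)
  qed
  have lim: "?X \<longlonglongrightarrow> vector [1, 0]"
  proof (rule vec_tendstoI)
    fix i :: 2
    show "(\<lambda>n. ?X n $ i) \<longlonglongrightarrow> vector [1, 0] $ i"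
      unfolding X using exhaust_2[of i] tendsto_diff[OF tendsto_const[of 1] LIMSEQ_inverse_real_of_nat]
        LIMSEQ_inverse_real_of_nat by auto
  qed
  have not_exp: "\<not> exponential_rate ?X"
  proof
    assume "exponential_rate ?X"
    then obtain L C r where L: "?X \<longlonglongrightarrow> L" and r: "0 < r" "r < 1"
      and bound: "\<And>n i. \<bar>?X n $ i - L $ i\<bar> < C * r ^ n"
      unfolding exponential_rate_def by blast
    have "L = vector [1, 0]" using L lim by (rule LIMSEQ_unique)
    then have "inverse (real (Suc n)) < C * r ^ n" for n
      using bound[of n 2] by (simp add: X)
    then have "1 < C * (real n * r ^ n + r ^ n)" for n
      by (simp add: field_simps)
    moreover have "(\<lambda>n. C * (real n * r ^ n + r ^ n)) \<longlonglongrightarrow> C * (0 + 0)"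
      using r by (intro tendsto_intros powser_times_n_limit_0 LIMSEQ_power_zero) auto
    ultimately have "1 \<le> C * (0 + 0)"
      by (intro LIMSEQ_le_const[of _ _ 1]) (auto intro: less_imp_le)
    then show False by simp
  qed
  show ?thesis
  proof (rule exists_single_matrix[where M = ?M and i = 1 and j = 1 and k = 2], goal_cases)
    case 1
    show ?case by (simp add: nonneg_mat_def forall_2)
  next
    case (2 n)
    show ?case using nz[of n] by auto
  next
    case 6
    have "nonneg_vec ?V" by (simp add: nonneg_vec_def forall_2)
    with nz not_exp convergentI[OF lim] show ?case
      by (intro exI[of _ ?V] conjI AE_single_letterI) (auto simp: powers_def)
  qed auto
qed

theorem mainTheorem2:
  "(\<forall>s A p. random_product_setting s A p \<and> some_not_monomial s A \<longrightarrow>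
      (AE \<omega> in product_prob s p.
         \<forall>L. seq_limit_point (\<lambda>n. normalize_mat (mat_product A \<omega> n)) L \<longrightarrow> rank L = 1) \<and>
      (\<forall>V. nonneg_vec V \<longrightarrow>
         (AE \<omega> in product_prob s p.
            (\<forall>n. mat_product A \<omega> n *v V \<noteq> 0) \<longrightarrow>
            convergent (\<lambda>n. normalize_vec (mat_product A \<omega> n *v V)))))
   \<and>
   (\<exists>s A p. random_product_setting s A p \<and> some_not_monomial s A \<and> inj_on A {..<s} \<and>
      (AE \<omega> in product_prob s p.
         (\<forall>n j. column j (mat_product A \<omega> n) \<noteq> 0) \<and>
         (\<exists>L1 L2. L1 \<noteq> L2 \<and>
            (\<lambda>n. normalize_vec (column 1 (mat_product A \<omega> n))) \<longlonglongrightarrow> L1 \<and>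
            (\<lambda>n. normalize_vec (column 2 (mat_product A \<omega> n))) \<longlonglongrightarrow> L2)))
   \<and>
   (\<exists>s A p. random_product_setting s A p \<and> some_not_monomial s A \<and> inj_on A {..<s} \<and>
      (\<forall>V. nonneg_vec V \<and> V \<noteq> 0 \<longrightarrow>
         (AE \<omega> in product_prob s p.
            (\<forall>n. mat_product A \<omega> n *v V \<noteq> 0) \<and>
            exponential_rate (\<lambda>n. normalize_vec (mat_product A \<omega> n *v V)))))
   \<and>
   (\<exists>s A p. random_product_setting s A p \<and> some_not_monomial s A \<and> inj_on A {..<s} \<and>
      (\<exists>V. nonneg_vec V \<and>
         (AE \<omega> in product_prob s p.
            (\<forall>n. mat_product A \<omega> n *v V \<noteq> 0) \<and>
            convergent (\<lambda>n. normalize_vec (mat_product A \<omega> n *v V)) \<and>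
            \<not> exponential_rate (\<lambda>n. normalize_vec (mat_product A \<omega> n *v V)))))"
proof (intro conjI exists_distinct_column_limits exists_exponential exists_not_exponential)
  show "\<forall>s A p. random_product_setting s A p \<and> some_not_monomial s A \<longrightarrow>
      (AE \<omega> in product_prob s p.
         \<forall>L. seq_limit_point (\<lambda>n. normalize_mat (mat_product A \<omega> n)) L \<longrightarrow> rank L = 1) \<and>
      (\<forall>V. nonneg_vec V \<longrightarrow>
         (AE \<omega> in product_prob s p.
            (\<forall>n. mat_product A \<omega> n *v V \<noteq> 0) \<longrightarrow>
            convergent (\<lambda>n. normalize_vec (mat_product A \<omega> n *v V))))"
  proof (intro allI impI, elim conjE, intro conjI allI impI)
    fix s :: nat and A :: "nat \<Rightarrow> real^2^2" and p :: "nat \<Rightarrow> real"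
    assume "random_product_setting s A p" "some_not_monomial s A"
    note limit = AE_limit_behaviour[OF this]
    have "AE \<omega> in product_prob s p. \<forall>n. mat_product A \<omega> n \<noteq> 0"
      using \<open>random_product_setting s A p\<close> by (simp add: random_product_setting_def)
    with limit show "AE \<omega> in product_prob s p.
        \<forall>L. seq_limit_point (\<lambda>n. normalize_mat (mat_product A \<omega> n)) L \<longrightarrow> rank L = 1"
      by eventually_elim (blast intro: rank_1_of_seq_limit_point)
    fix V :: "real^2" assume "nonneg_vec V"
    from limit show "AE \<omega> in product_prob s p. (\<forall>n. mat_product A \<omega> n *v V \<noteq> 0) \<longrightarrow>
        convergent (\<lambda>n. normalize_vec (mat_product A \<omega> n *v V))"
      by eventually_elim (use \<open>nonneg_vec V\<close> in blast)
  qed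
qed

end
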